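(* Let $l\geqslant 1$ and $\mathfrak g=\mathfrak{sl}_{l+1}(\mathbb C)$. For every integer $r\geqslant 0$, there is a bijection between the set of ad-nilpotent ideals $\mathfrak i$ of the Borel subalgebra $\mathfrak p_{\emptyset}$ such that $\sharp I_{\mathfrak i}=r$ and the set of Dyck paths of length $2l+2$ having exactly $r$ occurrences of "$udu$".
   Context: Let $\mathfrak h\subset\mathfrak g=\mathfrak{sl}_{l+1}(\mathbb C)$ be the subalgebra of trace zero diagonal matrices, and let $\epsilon_i$ be the linear form giving the $i$-th diagonal entry. The root system is $\Delta=\{\epsilon_i-\epsilon_j: 1\leqslant i,j\leqslant l+1, i\neq j\}$, with positive roots $\Delta^+=\{\epsilon_i-\epsilon_j: 1\leqslant i<j\leqslant l+1\}$ and simple roots $\Pi=\{\alpha_1,\dots,\alpha_l\}$, $\alpha_i=\epsilon_i-\epsilon_{i+1}$. For $\alpha\in\Delta$, $\mathfrak g_\alpha=\{x\in\mathfrak g: [h,x]=\alpha(h)x \text{ for all } h\in\mathfrak h\}$ is the root space. For $I\subset\Pi$ put $\Delta_I=\mathbb Z I\cap\Delta$ and let $\mathfrak p_I=\mathfrak h\oplus\bigoplus_{\alpha\in\Delta_I\cup\Delta^+}\mathfrak g_\alpha$ be the standard parabolic subalgebra; $\mathfrak p_\emptyset$ is a Borel subalgebra. An ideal $\mathfrak i$ of $\mathfrak p_I$ is ad-nilpotent if $\mathrm{ad}_{\mathfrak p_I}x$ is nilpotent for all $x\in\mathfrak i$. For an ad-nilpotent ideal $\mathfrak i$ of $\mathfrak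 p_\emptyset$, $I_{\mathfrak i}$ denotes the maximal subset $I\subset\Pi$ such that $\mathfrak i$ is an ad-nilpotent ideal of $\mathfrak p_I$. A Dyck path of length $2n$ is a word of $2n$ letters in $\{u,d\}$ with $n$ letters $u$ and $n$ letters $d$, such that every prefix contains at least as many $u$'s as $d$'s. An occurrence of "$udu$" is an occurrence as three consecutive letters (occurrences may overlap). *)

theory Defs
  imports "Jordan_Normal_Form.Matrix"
begin

text \<open>
  Rows and columns of the \<^typ>\<open>complex mat\<close>s below are numbered \<open>0, \<dots>, l\<close>. Thus \<open>eps l i\<close>
  is the linear form usually called \<open>\<epsilon>\<close> with index \<open>i + 1\<close>, and the simple roots are
  \<open>simple_root l 0, \<dots>, simple_root l (l - 1)\<close>.
\<close>

definition sl :: "nat \<Rightarrow> complex mat set" where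
  "sl l = {A \<in> carrier_mat (l + 1) (l + 1). (\<Sum>i<l + 1. A $$ (i, i)) = 0}"

definition bracket :: "complex mat \<Rightarrow> complex mat \<Rightarrow> complex mat" where
  "bracket A B = A * B - B * A"

definition cartan :: "nat \<Rightarrow> complex mat set" where
  "cartan l = {A \<in> sl l. diagonal_mat A}"

text \<open>
  Linear forms on the Cartan subalgebra are functions restricted to it, so that two of them are
  equal as functions iff they agree there.
\<close>

definition eps :: "nat \<Rightarrow> nat \<Rightarrow> complex mat \<Rightarrow> complex" where
  "eps l i = (\<lambda>h\<in>cartan l. h $$ (i, i))"

definition root :: "nat \<Rightarrow> nat \<Rightarrow> nat \<Rightarrow> complex mat \<Rightarrow> complex" where
  "root l i j = (\<lambda>h\<in>cartan l. eps l i h - eps l j h)"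

definition roots :: "nat \<Rightarrow> (complex mat \<Rightarrow> complex) set" where
  "roots l = {root l i j | i j. i \<le> l \<and> j \<le> l \<and> i \<noteq> j}"

definition pos_roots :: "nat \<Rightarrow> (complex mat \<Rightarrow> complex) set" where
  "pos_roots l = {root l i j | i j. i < j \<and> j \<le> l}"

definition simple_root :: "nat \<Rightarrow> nat \<Rightarrow> complex mat \<Rightarrow> complex" where
  "simple_root l i = root l i (i + 1)"

definition simple_roots :: "nat \<Rightarrow> (complex mat \<Rightarrow> complex) set" where
  "simple_roots l = {simple_root l i | i. i < l}"

definition root_space :: "nat \<Rightarrow> (complex mat \<Rightarrow> complex) \<Rightarrow> complex mat set" where
  "root_space l \<alpha> = {x \<in> sl l. \<forall>h\<in>cartan l. bracket h x = \<alpha> h \<cdot>\<^sub>m x}"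

definition int_span ::
    "nat \<Rightarrow> (complex mat \<Rightarrow> complex) set \<Rightarrow> (complex mat \<Rightarrow> complex) set" where
  "int_span l I = {(\<lambda>h\<in>cartan l. \<Sum>\<alpha>\<in>I. of_int (c \<alpha>) * \<alpha> h) | c :: _ \<Rightarrow> int. True}"

definition roots_gen ::
    "nat \<Rightarrow> (complex mat \<Rightarrow> complex) set \<Rightarrow> (complex mat \<Rightarrow> complex) set" where
  "roots_gen l I = int_span l I \<inter> roots l"

definition parabolic :: "nat \<Rightarrow> (complex mat \<Rightarrow> complex) set \<Rightarrow> complex mat set" where
  "parabolic l I =
     {h + finsum (module_mat TYPE(complex) (l + 1) (l + 1)) x (roots_gen l I \<union> pos_roots l) | h x.
        h \<in> cartan l \<and> (\<forall>\<alpha> \<in> roots_gen l I \<union> pos_roots l. x \<alpha> \<in> root_space l \<alpha>)}"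

definition lin_subspace :: "nat \<Rightarrow> complex mat set \<Rightarrow> bool" where
  "lin_subspace l V \<longleftrightarrow>
     V \<subseteq> carrier_mat (l + 1) (l + 1) \<and> 0\<^sub>m (l + 1) (l + 1) \<in> V \<and>
     (\<forall>x\<in>V. \<forall>y\<in>V. x + y \<in> V) \<and> (\<forall>c. \<forall>x\<in>V. c \<cdot>\<^sub>m x \<in> V)"

definition lie_ideal :: "nat \<Rightarrow> complex mat set \<Rightarrow> complex mat set \<Rightarrow> bool" where
  "lie_ideal l P N \<longleftrightarrow>
     lin_subspace l N \<and> N \<subseteq> P \<and> (\<forall>y\<in>P. \<forall>x\<in>N. bracket y x \<in> N)"

definition ad_nilpotent_on :: "nat \<Rightarrow> complex mat set \<Rightarrow> complex mat \<Rightarrow> bool" where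
  "ad_nilpotent_on l P x \<longleftrightarrow>
     (\<exists>k::nat. \<forall>y\<in>P. (bracket x ^^ k) y = 0\<^sub>m (l + 1) (l + 1))"

definition ad_nilpotent_ideal :: "nat \<Rightarrow> complex mat set \<Rightarrow> complex mat set \<Rightarrow> bool" where
  "ad_nilpotent_ideal l P N \<longleftrightarrow> lie_ideal l P N \<and> (\<forall>x\<in>N. ad_nilpotent_on l P x)"

text \<open>
  For an ad-nilpotent ideal \<open>N\<close> of the Borel subalgebra the greatest element below exists: if \<open>N\<close>
  is an ad-nilpotent ideal of \<open>parabolic l I\<close> and of \<open>parabolic l J\<close>, it is one of
  \<open>parabolic l (I \<union> J)\<close>, which they generate. So it is also the unique maximal such subset.
\<close>

definition max_simple :: "nat \<Rightarrow> complex mat set \<Rightarrow> (complex mat \<Rightarrow> complex) set" where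
  "max_simple l N =
     (GREATEST I. I \<subseteq> simple_roots l \<and> ad_nilpotent_ideal l (parabolic l I) N)"

datatype letter = Up | Down

definition dyck_path :: "nat \<Rightarrow> letter list \<Rightarrow> bool" where
  "dyck_path n w \<longleftrightarrow>
     length w = 2 * n \<and> count_list w Up = n \<and> count_list w Down = n \<and>
     (\<forall>k\<le>length w. count_list (take k w) Down \<le> count_list (take k w) Up)"

definition udu_count :: "letter list \<Rightarrow> nat" where
  "udu_count w =
     card {i. i + 2 < length w \<and> w ! i = Up \<and> w ! (i + 1) = Down \<and> w ! (i + 2) = Up}"

end

theory Submission
  imports Defs
begin

text \<open>
  Both sides are counted by words over the four pairs of truth values that stay at height
  \<open>\<ge> 0\<close> and end at height \<open>0\<close>, where \<open>(True, False)\<close> is a step up, \<open>(False, True)\<close> a step down,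
  and \<open>(True, True)\<close>, \<open>(False, False)\<close> are level steps of two colours: Motzkin words of length
  \<open>l\<close> with two-coloured level steps. On either side the parameter \<open>r\<close> is the number of level steps
  of the second colour.

  \<^emph>\<open>Ideals.\<close> An element of an ideal of the Borel subalgebra that acts nilpotently has zero
  diagonal, and the torus separates the matrix positions; so an ad-nilpotent ideal is the space of
  all matrices supported on an up-closed set \<open>\<Phi>\<close> of positive roots, each root written as a position
  \<open>(i, j)\<close> with \<open>i < j\<close> (\<open>ad_nilpotent_ideal_borel_iff\<close>). The negative of the simple root of index
  \<open>k\<close> moves row \<open>k\<close> to row \<open>k + 1\<close> and column \<open>k + 1\<close> to column \<open>k\<close>. It preserves the ideal
  exactly if the staircase boundary of \<open>\<Phi>\<close> has no corner, that is \<open>\<Phi>\<close> no minimal root, in row \<open>k\<close>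
  or in column \<open>k + 1\<close>. So the greatest \<open>I\<close> consists of the simple roots whose row and column are both
  free of corners (\<open>max_simple_supported\<close>).

  \<^emph>\<open>From ideals to words.\<close> The letter at position \<open>k\<close> records whether there is a corner in row \<open>k\<close>
  and whether there is one in column \<open>k + 1\<close>. The minimal roots form an antichain, so going down
  the staircase their rows and their columns increase together: the set of corner rows and the set
  of corner columns determine \<open>\<Phi>\<close>, and the condition \<open>i < j\<close> says that the word never goes below
  height \<open>0\<close> (\<open>bij_corner_word\<close>). The simple roots of the greatest \<open>I\<close> become the
  letters \<open>(False, False)\<close>.

  \<^emph>\<open>From words to Dyck paths.\<close> A nonempty Dyck path is uniquely \<open>u A d B\<close> with Dyck paths \<open>A\<close> and
  \<open>B\<close>. According to which of the two are empty, it is a leaf, one of two kinds of unary node or a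
  binary node of a tree. An occurrence of \<open>udu\<close> at the very beginning means that \<open>A\<close> is empty
  and \<open>B\<close> is not, and all others lie inside \<open>A\<close> or \<open>B\<close>; so \<open>udu\<close> counts the unary nodes of
  one kind. Decomposing a Motzkin word at its first step gives the same trees: empty, one of two
  level steps followed by a word, or an up step, a word, a down step and a word.
\<close>

section \<open>Balanced words and their first return\<close>

text \<open>
  The function \<open>h\<close> assigns to each letter its change of height. Dyck paths and Motzkin words are
  the instances for their respective alphabets.
\<close>

definition balanced :: "('a \<Rightarrow> int) \<Rightarrow> 'a list \<Rightarrow> bool" where
  "balanced h xs \<longleftrightarrow>
     sum_list (map h xs) = 0 \<and> (\<forall>k. 0 \<le> sum_list (map h (take k xs)))"

lemma balanced_Nil [simp]: "balanced h []"
  by (simp add: balanced_def)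

lemma balanced_Cons_level:
  assumes "h x = 0"
  shows "balanced h (x # xs) \<longleftrightarrow> balanced h xs"
proof
  assume *: "balanced h (x # xs)"
  have "0 \<le> sum_list (map h (take k xs))" for k
    using * assms unfolding balanced_def by (auto dest: spec[of _ "Suc k"])
  then show "balanced h xs"
    using * assms by (auto simp: balanced_def)
next
  assume *: "balanced h xs"
  have "0 \<le> sum_list (map h (take k (x # xs)))" for k
    using * assms unfolding balanced_def by (cases k) auto
  then show "balanced h (x # xs)"
    using * assms by (auto simp: balanced_def)
qed

lemma balanced_arch:
  assumes "h u = 1" "h d = -1" "balanced h A" "balanced h B"
  shows "balanced h (u # A @ d # B)"
proof -
  have "0 \<le> sum_list (map h (take k (u # A @ d # B)))" for k
  proof (cases k)
    case (Suc m)
    show ?thesis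
    proof (cases "m - length A")
      case 0
      then have "take m (A @ d # B) = take m A" by simp
      moreover have "0 \<le> sum_list (map h (take m A))"
        using assms by (auto simp: balanced_def)
      ultimately show ?thesis using assms Suc by auto
    next
      case (Suc j)
      then have "take m (A @ d # B) = A @ d # take j B" by simp
      moreover have "0 \<le> sum_list (map h (take j B))" "sum_list (map h A) = 0"
        using assms by (auto simp: balanced_def)
      ultimately show ?thesis using assms \<open>k = Suc m\<close> by auto
    qed
  qed simp
  then show ?thesis
    using assms by (auto simp: balanced_def)
qed

text \<open>
  The first return to height \<open>0\<close>: the letter \<open>d\<close> is the first one at which \<open>xs\<close>, which starts
  at height \<open>1\<close>, has reached \<open>0\<close>. It exists because no letter descends by more than \<open>1\<close>.
\<close>

lemma balanced_splitE:
  assumes bal: "balanced h (u # xs)" and u: "h u = 1" and h: "\<And>y. h y \<ge> -1"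
  obtains A d B where "xs = A @ d # B" "h d = -1" "balanced h A" "balanced h B"
proof -
  let ?S = "\<lambda>k. sum_list (map h (take k xs))"
  have tot: "sum_list (map h xs) = -1"
    using bal u by (simp add: balanced_def)
  have pre: "?S k \<ge> -1" for k
    using bal u unfolding balanced_def by (auto dest: spec[of _ "Suc k"])
  define k where "k = (LEAST k. ?S k < 0)"
  have "?S (length xs) < 0" using tot by simp
  then have neg: "?S k < 0" unfolding k_def by (rule LeastI)
  have pos: "?S j \<ge> 0" if "j < k" for j
    using not_less_Least[of j "\<lambda>k. ?S k < 0"] that by (auto simp: k_def)
  obtain m where m: "k = Suc m" using neg by (cases k) auto
  have "m < length xs"
  proof (rule ccontr)
    assume "\<not> m < length xs"
    then have "?S k = ?S m" using m by simp
    then show False using neg pos[of m] m by simp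
  qed
  define A B d where "A = take m xs" and "B = drop (Suc m) xs" and "d = xs ! m"
  have xs: "xs = A @ d # B"
    using \<open>m < length xs\<close> by (simp add: A_def B_def d_def id_take_nth_drop[symmetric])
  have lA: "length A = m" using \<open>m < length xs\<close> by (simp add: A_def)
  have "sum_list (map h A) + h d < 0" "sum_list (map h A) \<ge> 0"
    using neg pos[of m] m lA by (auto simp: xs)
  then have d: "h d = -1" and A0: "sum_list (map h A) = 0"
    using h[of d] by linarith+
  have "sum_list (map h (take j A)) \<ge> 0" for j
    using pos[of "min j m"] m by (simp add: A_def min.commute)
  then have "balanced h A" using A0 by (simp add: balanced_def)
  moreover have "sum_list (map h (take j B)) \<ge> 0" for j
    using pre[of "Suc m + j"] A0 d lA by (simp add: xs)
  then have "balanced h B" using tot A0 d by (simp add: balanced_def xs)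
  ultimately show thesis using that xs d by blast
qed

text \<open>
  If one of \<open>A\<close>, \<open>A'\<close> were longer, it would contain the other one followed by a step down, hence
  a prefix of negative height.
\<close>

lemma balanced_split_unique:
  assumes eq: "A @ d # B = A' @ d' # B'"
    and "balanced h A" "balanced h A'" "h d = -1" "h d' = -1"
  shows "A = A' \<and> d = d' \<and> B = B'"
proof -
  \<comment> \<open>A balanced word has no prefix consisting of a balanced word and a step down.\<close>
  have less: False
    if bal: "balanced h X" "balanced h (X @ y # Y)" and y: "h y = -1" for X y Y
  proof -
    have "0 \<le> sum_list (map h (take (Suc (length X)) (X @ y # Y)))"
      using bal(2) unfolding balanced_def by blast
    then show False using bal(1) y by (simp add: balanced_def)
  qed
  from eq obtain us where
    "A = A' @ us \<and> us @ d # B = d' # B' \<or> A @ us = A' \<and> d # B = us @ d' # B'"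
    unfolding append_eq_append_conv2 by blast
  then show ?thesis
    using assms less by (cases us) auto
qed

section \<open>Trees, two-coloured Motzkin words and Dyck paths\<close>

text \<open>
  The common shape of Motzkin words with two-coloured level steps and of nonempty Dyck paths.
\<close>

datatype tree = Leaf | Level1 tree | Level2 tree | Branch tree tree

primrec level2_count :: "tree \<Rightarrow> nat" where
  "level2_count Leaf = 0"
| "level2_count (Level1 t) = level2_count t"
| "level2_count (Level2 t) = Suc (level2_count t)"
| "level2_count (Branch s t) = level2_count s + level2_count t"

text \<open>
  The height depends on the two components separately: steps with true first component count
  upwards, steps with true second component downwards.
\<close>

definition step_height :: "bool \<times> bool \<Rightarrow> int" where
  "step_height p = of_bool (fst p) - of_bool (snd p)"

primrec tree_motzkin :: "tree \<Rightarrow> (bool \<times> bool) list" where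
  "tree_motzkin Leaf = []"
| "tree_motzkin (Level1 t) = (True, True) # tree_motzkin t"
| "tree_motzkin (Level2 t) = (False, False) # tree_motzkin t"
| "tree_motzkin (Branch s t) = (True, False) # tree_motzkin s @ (False, True) # tree_motzkin t"

lemma step_height_simps [simp]:
  "step_height (True, True) = 0" "step_height (False, False) = 0"
  "step_height (True, False) = 1" "step_height (False, True) = -1"
  by (simp_all add: step_height_def)

lemma balanced_tree_motzkin: "balanced step_height (tree_motzkin t)"
  by (induction t) (auto simp: balanced_Cons_level intro: balanced_arch)

lemma inj_tree_motzkin: "inj tree_motzkin"
proof (rule injI)
  fix s t show "tree_motzkin s = tree_motzkin t \<Longrightarrow> s = t"
  proof (induction s arbitrary: t)
    case (Branch s1 s2)
    then obtain t1 t2 where t: "t = Branch t1 t2" by (cases t) auto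
    have "tree_motzkin s1 = tree_motzkin t1 \<and> (False, True) = (False, True)
        \<and> tree_motzkin s2 = tree_motzkin t2"
      by (rule balanced_split_unique[where h = step_height])
        (use Branch.prems t in \<open>auto simp: balanced_tree_motzkin\<close>)
    then show ?case using Branch.IH t by auto
  qed (case_tac t; auto)+
qed

lemma surj_tree_motzkin: "balanced step_height xs \<Longrightarrow> xs \<in> range tree_motzkin"
proof (induction xs rule: length_induct)
  case (1 xs)
  show ?case
  proof (cases xs)
    case Nil
    then show ?thesis by (metis range_eqI tree_motzkin.simps(1))
  next
    case (Cons x ys)
    consider "x = (True, True)" | "x = (False, False)" | "x = (True, False)" | "x = (False, True)"
      by (cases x) auto
    then show ?thesis
    proof cases
      case 1
      then have "balanced step_height ys" using "1.prems" Cons by (simp add: balanced_Cons_level)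
      then obtain t where "ys = tree_motzkin t" using "1.IH" Cons by auto
      then show ?thesis using Cons 1 by (metis range_eqI tree_motzkin.simps(2))
    next
      case 2
      then have "balanced step_height ys" using "1.prems" Cons by (simp add: balanced_Cons_level)
      then obtain t where "ys = tree_motzkin t" using "1.IH" Cons by auto
      then show ?thesis using Cons 2 by (metis range_eqI tree_motzkin.simps(3))
    next
      case 3
      obtain A d B where ys: "ys = A @ d # B" "step_height d = -1"
        and AB: "balanced step_height A" "balanced step_height B"
      proof (rule balanced_splitE[of step_height x ys])
        show "step_height y \<ge> -1" for y by (simp add: step_height_def)
      qed (use "1.prems" Cons 3 in auto)
      have "\<exists>s. A = tree_motzkin s" "\<exists>t. B = tree_motzkin t"
        using "1.IH" Cons ys AB by (auto simp: image_iff)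
      then obtain s t where "A = tree_motzkin s" "B = tree_motzkin t" by blast
      moreover have "d = (False, True)"
        using ys(2) by (cases d; cases "fst d"; cases "snd d") (auto simp: step_height_def)
      ultimately show ?thesis using Cons ys 3 by (metis range_eqI tree_motzkin.simps(4))
    next
      case 4
      then show ?thesis
        using "1.prems" Cons unfolding balanced_def by (auto dest!: spec[of _ 1])
    qed
  qed
qed

lemma level2_count_motzkin: "count_list (tree_motzkin t) (False, False) = level2_count t"
  by (induction t) auto

fun letter_height :: "letter \<Rightarrow> int" where
  "letter_height Up = 1"
| "letter_height Down = -1"

definition arch :: "letter list \<Rightarrow> letter list \<Rightarrow> letter list" where
  "arch A B = Up # A @ Down # B"

text \<open>
  The path \<open>arch A B\<close> is cut at its first return to height \<open>0\<close>; the constructor tells which of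
  \<open>A\<close> and \<open>B\<close> are empty. A leaf is \<open>ud\<close>, so that all paths obtained are nonempty.
\<close>

primrec tree_dyck :: "tree \<Rightarrow> letter list" where
  "tree_dyck Leaf = arch [] []"
| "tree_dyck (Level1 t) = arch (tree_dyck t) []"
| "tree_dyck (Level2 t) = arch [] (tree_dyck t)"
| "tree_dyck (Branch s t) = arch (tree_dyck s) (tree_dyck t)"

lemma arch_neq_Nil [simp]: "arch A B \<noteq> []"
  by (simp add: arch_def)

lemma tree_dyck_neq_Nil [simp]: "tree_dyck t \<noteq> []"
  by (cases t) auto

lemma balanced_letter_arch:
  "balanced letter_height A \<Longrightarrow> balanced letter_height B \<Longrightarrow> balanced letter_height (arch A B)"
  unfolding arch_def by (rule balanced_arch) auto

lemma arch_eq_iff: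
  assumes "balanced letter_height A" "balanced letter_height A'"
  shows "arch A B = arch A' B' \<longleftrightarrow> A = A' \<and> B = B'"
  using balanced_split_unique[of A Down B A' Down B' letter_height] assms
  by (auto simp: arch_def)

lemma balanced_tree_dyck: "balanced letter_height (tree_dyck t)"
  by (induction t) (auto intro: balanced_letter_arch)

lemma inj_tree_dyck: "inj tree_dyck"
proof (rule injI)
  fix s t show "tree_dyck s = tree_dyck t \<Longrightarrow> s = t"
    by (induction s arbitrary: t; case_tac t)
      (auto simp: arch_eq_iff balanced_tree_dyck tree_dyck_neq_Nil[symmetric])
qed

lemma surj_tree_dyck: "balanced letter_height xs \<Longrightarrow> xs \<noteq> [] \<Longrightarrow> xs \<in> range tree_dyck"
proof (induction xs rule: length_induct)
  case (1 xs)
  from "1.prems" obtain ys where Cons: "xs = Up # ys"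
  proof (cases xs)
    case (Cons x ys)
    then have "0 \<le> letter_height x"
      using "1.prems" unfolding balanced_def by (auto dest!: spec[of _ 1])
    then show thesis using Cons that by (cases x) auto
  qed auto
  obtain A d B where ys: "ys = A @ d # B" "letter_height d = -1"
    and AB: "balanced letter_height A" "balanced letter_height B"
  proof (rule balanced_splitE[of letter_height Up ys])
    show "letter_height y \<ge> -1" for y by (cases y) auto
  qed (use "1.prems" Cons in auto)
  have "d = Down" using ys(2) by (cases d) auto
  then have xs: "xs = arch A B" using Cons ys by (simp add: arch_def)
  have IH: "\<exists>t. C = tree_dyck t" if "C = A \<or> C = B" "C \<noteq> []" for C
  proof -
    have "length C < length xs" using Cons ys that by auto
    then show ?thesis using "1.IH" AB that by blast
  qed
  have "\<exists>t. xs = tree_dyck t"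
  proof (cases "A = []"; cases "B = []")
    assume "A = []" "B = []"
    then show ?thesis using xs by (intro exI[of _ Leaf]) simp
  next
    assume "A = []" "B \<noteq> []"
    then obtain t where "B = tree_dyck t" using IH by blast
    then show ?thesis using xs \<open>A = []\<close> by (intro exI[of _ "Level2 t"]) simp
  next
    assume "A \<noteq> []" "B = []"
    then obtain t where "A = tree_dyck t" using IH by blast
    then show ?thesis using xs \<open>B = []\<close> by (intro exI[of _ "Level1 t"]) simp
  next
    assume "A \<noteq> []" "B \<noteq> []"
    then obtain s t where "A = tree_dyck s" "B = tree_dyck t" using IH by blast
    then show ?thesis using xs by (intro exI[of _ "Branch s t"]) simp
  qed
  then show ?case by blast
qed

lemma length_tree_dyck: "length (tree_dyck t) = 2 * (length (tree_motzkin t) + 1)"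
  by (induction t) (auto simp: arch_def)

lemma udu_count_Cons:
  "udu_count (x # xs) = of_bool (x = Up \<and> take 2 xs = [Down, Up]) + udu_count xs"
proof -
  define Occ where "Occ w = {i. i + 2 < length w \<and> w ! i = Up \<and> w ! (i + 1) = Down \<and> w ! (i + 2) = Up}"
    for w :: "letter list"
  have fin: "finite (Occ w)" for w
    by (rule finite_subset[of _ "{..<length w}"]) (auto simp: Occ_def)
  have head: "0 \<in> Occ (x # xs) \<longleftrightarrow> x = Up \<and> take 2 xs = [Down, Up]"
    by (cases xs; cases "tl xs") (auto simp: Occ_def numeral_2_eq_2)
  have "Occ (x # xs) = {i \<in> Occ (x # xs). i = 0} \<union> Suc ` Occ xs"
  proof (intro equalityI subsetI)
    fix i assume "i \<in> Occ (x # xs)"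
    then show "i \<in> {i \<in> Occ (x # xs). i = 0} \<union> Suc ` Occ xs"
      by (cases i) (auto simp: Occ_def)
  qed (auto simp: Occ_def)
  moreover have "card ({i \<in> Occ (x # xs). i = 0} \<union> Suc ` Occ xs)
      = card {i \<in> Occ (x # xs). i = 0} + card (Occ xs)"
    by (subst card_Un_disjoint) (auto simp: fin card_image)
  moreover have "{i \<in> Occ (x # xs). i = 0} = (if 0 \<in> Occ (x # xs) then {0} else {})"
    by auto
  ultimately have "card (Occ (x # xs)) = of_bool (0 \<in> Occ (x # xs)) + card (Occ xs)"
    by auto
  then show ?thesis
    unfolding head by (simp add: Occ_def udu_count_def)
qed

lemma udu_count_Nil: "udu_count [] = 0"
  by (simp add: udu_count_def)

text \<open>
  In \<open>udu\<close> the letter \<open>d\<close> comes right after a \<open>u\<close>, so no occurrence contains the second \<open>d\<close> of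
  \<open>dd\<close>: each lies in front of it or behind it.
\<close>

lemma udu_count_Down_Down:
  "udu_count (xs @ Down # Down # ys) = udu_count (xs @ [Down]) + udu_count ys"
proof (induction xs)
  case (Cons x xs)
  have "take 2 (xs @ Down # Down # ys) = [Down, Up] \<longleftrightarrow> take 2 (xs @ [Down]) = [Down, Up]"
    by (cases xs; cases "tl xs") (auto simp: numeral_2_eq_2)
  then show ?case using Cons by (simp add: udu_count_Cons)
qed (simp add: udu_count_Cons udu_count_Nil)

lemma tree_dyck_Up: "\<exists>ys. tree_dyck t = Up # ys"
  by (cases t) (auto simp: arch_def)

lemma tree_dyck_Down: "\<exists>ys. tree_dyck t = ys @ [Down]"
proof (induction t)
  case (Branch s t)
  then obtain ys where "tree_dyck t = ys @ [Down]" by blast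
  then have "tree_dyck (Branch s t) = (Up # tree_dyck s @ Down # ys) @ [Down]"
    by (simp add: arch_def)
  then show ?case by blast
next
  case (Level2 t)
  then obtain ys where "tree_dyck t = ys @ [Down]" by blast
  then have "tree_dyck (Level2 t) = (Up # Down # ys) @ [Down]"
    by (simp add: arch_def)
  then show ?case by blast
qed (auto simp: arch_def)

text \<open>
  A nonempty Dyck path starts with \<open>u\<close> and ends with \<open>d\<close>. So the leading \<open>u\<close> of the arch is
  followed by \<open>u\<close>, and the returning step is preceded by \<open>d\<close>: no new occurrence of \<open>udu\<close> arises.
\<close>

lemma udu_count_arch:
  "udu_count (arch (tree_dyck t) B) = udu_count (tree_dyck t) + udu_count B"
proof -
  obtain ys where ys: "tree_dyck t = ys @ [Down]" using tree_dyck_Down by blast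
  obtain zs where zs: "tree_dyck t = Up # zs" using tree_dyck_Up by blast
  have "udu_count (arch (tree_dyck t) B) = udu_count (tree_dyck t @ Down # B)"
    by (simp add: arch_def udu_count_Cons zs numeral_2_eq_2)
  also have "\<dots> = udu_count (ys @ Down # Down # B)" by (simp add: ys)
  also have "\<dots> = udu_count (tree_dyck t) + udu_count B"
    by (simp add: udu_count_Down_Down ys)
  finally show ?thesis .
qed

lemma udu_count_tree_dyck: "udu_count (tree_dyck t) = level2_count t"
proof (induction t)
  case Leaf
  show ?case by (simp add: arch_def udu_count_Cons udu_count_Nil)
next
  case (Level2 t)
  obtain zs where "tree_dyck t = Up # zs" using tree_dyck_Up by blast
  then show ?case using Level2 by (simp add: arch_def udu_count_Cons numeral_2_eq_2)
qed (simp_all add: udu_count_arch udu_count_Nil)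

lemma sum_letter_height:
  "sum_list (map letter_height w) = int (count_list w Up) - int (count_list w Down)"
proof (induction w)
  case (Cons x w)
  then show ?case by (cases x) auto
qed simp

lemma dyck_path_iff_balanced:
  "dyck_path n w \<longleftrightarrow> length w = 2 * n \<and> balanced letter_height w"
proof -
  have len: "length w = count_list w Up + count_list w Down"
  proof (induction w)
    case (Cons x w)
    then show ?case by (cases x) auto
  qed simp
  have pre: "(\<forall>k\<le>length w. count_list (take k w) Down \<le> count_list (take k w) Up)
      \<longleftrightarrow> (\<forall>k. count_list (take k w) Down \<le> count_list (take k w) Up)"
    by (metis le_refl nat_le_linear take_all)
  show ?thesis
    unfolding dyck_path_def balanced_def sum_letter_height pre using len by auto
qed

lemma bij_tree_motzkin:
  "bij_betw tree_motzkin {t. length (tree_motzkin t) = l \<and> level2_count t = r}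
     {xs. length xs = l \<and> balanced step_height xs \<and> count_list xs (False, False) = r}"
  unfolding bij_betw_def
proof
  show "inj_on tree_motzkin {t. length (tree_motzkin t) = l \<and> level2_count t = r}"
    using inj_tree_motzkin by (rule inj_on_subset) simp
  show "tree_motzkin ` {t. length (tree_motzkin t) = l \<and> level2_count t = r}
      = {xs. length xs = l \<and> balanced step_height xs \<and> count_list xs (False, False) = r}"
    by (auto simp: balanced_tree_motzkin level2_count_motzkin dest!: surj_tree_motzkin)
qed

lemma bij_tree_dyck:
  "bij_betw tree_dyck {t. length (tree_motzkin t) = l \<and> level2_count t = r}
     {w. dyck_path (l + 1) w \<and> udu_count w = r}"
  unfolding bij_betw_def
proof
  show "inj_on tree_dyck {t. length (tree_motzkin t) = l \<and> level2_count t = r}"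
    using inj_tree_dyck by (rule inj_on_subset) simp
  have "w \<in> tree_dyck ` {t. length (tree_motzkin t) = l \<and> level2_count t = r}"
    if w: "dyck_path (l + 1) w" "udu_count w = r" for w
  proof -
    have "balanced letter_height w" "w \<noteq> []" "length w = 2 * (l + 1)"
      using w by (auto simp: dyck_path_iff_balanced)
    then obtain t where "w = tree_dyck t" using surj_tree_dyck by blast
    then show ?thesis
      using w \<open>length w = _\<close> by (auto simp: length_tree_dyck udu_count_tree_dyck)
  qed
  then show "tree_dyck ` {t. length (tree_motzkin t) = l \<and> level2_count t = r}
      = {w. dyck_path (l + 1) w \<and> udu_count w = r}"
    by (auto simp: dyck_path_iff_balanced balanced_tree_dyck length_tree_dyck udu_count_tree_dyck)
qed

section \<open>Up-closed sets of positive roots as Motzkin words\<close>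

abbreviation cnt :: "nat set \<Rightarrow> nat \<Rightarrow> nat" where
  "cnt A k \<equiv> card (A \<inter> {..<k})"

lemma cnt_Suc: "cnt A (Suc k) = of_bool (k \<in> A) + cnt A k"
  by (simp add: lessThan_Suc)

lemma cnt_mono: "j \<le> k \<Longrightarrow> cnt A j \<le> cnt A k"
  by (intro card_mono) auto

lemma cnt_eq_card: "A \<subseteq> {..<l} \<Longrightarrow> l \<le> k \<Longrightarrow> cnt A k = card A"
  by (rule arg_cong[of _ _ card]) auto

text \<open>
  A discrete intermediate value property: the counts increase by at most \<open>1\<close> at a time.
\<close>

lemma cnt_attains: "m \<le> cnt A n \<Longrightarrow> \<exists>k\<le>n. cnt A k = m"
proof (induction n)
  case (Suc n)
  show ?case
  proof (cases "m \<le> cnt A n")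
    case True
    then show ?thesis using Suc.IH le_SucI by blast
  next
    case False
    then have "cnt A (Suc n) = m" using Suc.prems by (cases "n \<in> A") (auto simp: cnt_Suc)
    then show ?thesis by blast
  qed
qed simp

definition fst_positions :: "(bool \<times> bool) list \<Rightarrow> nat set" where
  "fst_positions xs = {k. k < length xs \<and> fst (xs ! k)}"

definition snd_positions :: "(bool \<times> bool) list \<Rightarrow> nat set" where
  "snd_positions xs = {k. k < length xs \<and> snd (xs ! k)}"

lemma positions_subset:
  "fst_positions xs \<subseteq> {..<length xs}" "snd_positions xs \<subseteq> {..<length xs}"
  by (auto simp: fst_positions_def snd_positions_def)

lemma sum_step_height_take:
  "sum_list (map step_height (take k xs)) = int (cnt (fst_positions xs) k) - int (cnt (snd_positions xs) k)"
proof (induction k)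
  case (Suc k)
  show ?case
  proof (cases "k < length xs")
    case True
    then show ?thesis
      using Suc by (simp add: take_Suc_conv_app_nth cnt_Suc step_height_def fst_positions_def
          snd_positions_def)
  next
    case False
    then show ?thesis using Suc by (simp add: cnt_Suc fst_positions_def snd_positions_def)
  qed
qed simp

lemma balanced_iff_positions:
  "balanced step_height xs \<longleftrightarrow> card (fst_positions xs) = card (snd_positions xs)
     \<and> (\<forall>k. cnt (snd_positions xs) k \<le> cnt (fst_positions xs) k)"
  using sum_step_height_take[of "length xs" xs]
  by (simp add: balanced_def sum_step_height_take
      cnt_eq_card[OF positions_subset(1)] cnt_eq_card[OF positions_subset(2)])

text \<open>
  The up-closed subsets of the poset of positive roots. The pair \<open>(i, j)\<close> stands for the root
  \<^term>\<open>root l i j\<close>; adding a positive root to it makes \<open>i\<close> smaller or \<open>j\<close> larger.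
\<close>

definition root_ideals :: "nat \<Rightarrow> (nat \<times> nat) set set" where
  "root_ideals l = {\<Phi>. (\<forall>i j. (i, j) \<in> \<Phi> \<longrightarrow> i < j \<and> j \<le> l) \<and>
     (\<forall>i j i' j'. (i, j) \<in> \<Phi> \<longrightarrow> i' \<le> i \<longrightarrow> j \<le> j' \<longrightarrow> j' \<le> l \<longrightarrow> (i', j') \<in> \<Phi>)}"

text \<open>
  The rows and the columns with a corner of the staircase that bounds \<open>\<Phi>\<close>. The corner in column
  \<open>j + 1\<close> is recorded as \<open>j\<close>: the corners can lie in rows \<open>0, \<dots>, l - 1\<close> and in columns
  \<open>1, \<dots>, l\<close>, and the shift makes both sets subsets of \<open>{..<l}\<close>. A simple root of index \<open>k\<close> is then
  concerned with the number \<open>k\<close> in either set.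
\<close>

definition row_corners :: "(nat \<times> nat) set \<Rightarrow> nat set" where
  "row_corners \<Phi> = {i. \<exists>j. (i, j) \<in> \<Phi> \<and> (Suc i, j) \<notin> \<Phi>}"

definition col_corners :: "(nat \<times> nat) set \<Rightarrow> nat set" where
  "col_corners \<Phi> = {j. \<exists>i. (i, Suc j) \<in> \<Phi> \<and> (i, j) \<notin> \<Phi>}"

definition corner_word :: "nat \<Rightarrow> (nat \<times> nat) set \<Rightarrow> (bool \<times> bool) list" where
  "corner_word l \<Phi> = map (\<lambda>k. (k \<in> row_corners \<Phi>, k \<in> col_corners \<Phi>)) [0..<l]"

text \<open>
  The inverse of \<open>corner_word\<close>. The root \<open>(i, j)\<close> belongs to the ideal iff some corner lies in
  row \<open>\<ge> i\<close> and in column \<open>\<le> j\<close>. As rows and columns of corners increase together, this means that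
  more corners have column \<open>\<le> j\<close> than have row \<open>< i\<close>.
\<close>

definition word_ideal :: "(bool \<times> bool) list \<Rightarrow> (nat \<times> nat) set" where
  "word_ideal xs = {(i, j). i \<le> length xs \<and> j \<le> length xs \<and>
     cnt (fst_positions xs) i < cnt (snd_positions xs) j}"

lemma root_idealsD:
  assumes "\<Phi> \<in> root_ideals l" "(i, j) \<in> \<Phi>"
  shows "i < j" "j \<le> l"
  using assms by (auto simp: root_ideals_def)

lemma root_ideals_up:
  assumes "\<Phi> \<in> root_ideals l" "(i, j) \<in> \<Phi>" "i' \<le> i" "j \<le> j'" "j' \<le> l"
  shows "(i', j') \<in> \<Phi>"
  using assms unfolding root_ideals_def by blast

lemma corners_subset:
  assumes "\<Phi> \<in> root_ideals l"
  shows "row_corners \<Phi> \<subseteq> {..<l}" "col_corners \<Phi> \<subseteq> {..<l}"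
  using root_idealsD[OF assms] by (fastforce simp: row_corners_def col_corners_def)+

lemma positions_corner_word:
  assumes "\<Phi> \<in> root_ideals l"
  shows "fst_positions (corner_word l \<Phi>) = row_corners \<Phi>"
    and "snd_positions (corner_word l \<Phi>) = col_corners \<Phi>"
  using corners_subset[OF assms]
  by (auto simp: fst_positions_def snd_positions_def corner_word_def)

text \<open>
  The minimal elements of \<open>\<Phi>\<close>, with the second coordinate lowered by \<open>1\<close> as in \<open>col_corners\<close>.
\<close>

definition minimal_roots :: "(nat \<times> nat) set \<Rightarrow> (nat \<times> nat) set" where
  "minimal_roots \<Phi> = {(i, j). (i, Suc j) \<in> \<Phi> \<and> (Suc i, Suc j) \<notin> \<Phi> \<and> (i, j) \<notin> \<Phi>}"

text \<open>
  Move to the left in row \<open>i\<close> as far as possible, then down in the column reached.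
\<close>

lemma minimal_root_below:
  assumes \<Phi>: "\<Phi> \<in> root_ideals l" and ij: "(i, j) \<in> \<Phi>"
  obtains i' j' where "(i', j') \<in> minimal_roots \<Phi>" "i \<le> i'" "j' < j"
proof -
  define m where "m = (LEAST m. (i, m) \<in> \<Phi>)"
  have m: "(i, m) \<in> \<Phi>" "m \<le> j"
    unfolding m_def using ij by (auto intro: LeastI Least_le)
  have m_least: "(i, k) \<notin> \<Phi>" if "k < m" for k
    using not_less_Least that unfolding m_def by blast
  obtain j' where j': "m = Suc j'"
    using root_idealsD[OF \<Phi> m(1)] by (cases m) auto
  define n where "n = (GREATEST n. (n, m) \<in> \<Phi>)"
  have bound: "k \<le> m" if "(k, m) \<in> \<Phi>" for k
    using root_idealsD(1)[OF \<Phi> that] by simp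
  have n: "(n, m) \<in> \<Phi>" "i \<le> n"
    unfolding n_def using m(1) bound
    by (auto intro: GreatestI_nat[of "\<lambda>n. (n, m) \<in> \<Phi>" i m] Greatest_le_nat[of "\<lambda>n. (n, m) \<in> \<Phi>" i m])
  have "(Suc n, m) \<notin> \<Phi>"
    using Greatest_le_nat[of "\<lambda>n. (n, m) \<in> \<Phi>" "Suc n" m] bound unfolding n_def by fastforce
  moreover have "(n, j') \<notin> \<Phi>"
    using root_ideals_up[OF \<Phi>, of n j' i j'] n m_least[of j'] j' root_idealsD[OF \<Phi>] by fastforce
  ultimately have "(n, j') \<in> minimal_roots \<Phi>"
    using n j' by (simp add: minimal_roots_def)
  then show thesis using that n m j' by force
qed

text \<open>
  This is where minimality enters: two distinct minimal elements are incomparable, and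
  incomparability in this order means that both coordinates are ordered in the same way.
\<close>

lemma minimal_roots_chain:
  assumes \<Phi>: "\<Phi> \<in> root_ideals l"
    and p: "(i, j) \<in> minimal_roots \<Phi>" and q: "(i', j') \<in> minimal_roots \<Phi>"
  shows "i < i' \<longleftrightarrow> j < j'"
proof -
  have mem: "(i, Suc j) \<in> \<Phi>" "(Suc i, Suc j) \<notin> \<Phi>" "(i', Suc j') \<in> \<Phi>" "(i', j') \<notin> \<Phi>"
    using p q by (auto simp: minimal_roots_def)
  have l: "Suc j \<le> l" "Suc j' \<le> l" using mem root_idealsD[OF \<Phi>] by auto
  show ?thesis
  proof
    assume "i < i'"
    show "j < j'"
    proof (rule ccontr)
      assume "\<not> j < j'"
      then have "(Suc i, Suc j) \<in> \<Phi>"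
        using root_ideals_up[OF \<Phi> mem(3), of "Suc i" "Suc j"] \<open>i < i'\<close> l by simp
      then show False using mem by blast
    qed
  next
    assume "j < j'"
    show "i < i'"
    proof (rule ccontr)
      assume "\<not> i < i'"
      then have "(i', j') \<in> \<Phi>"
        using root_ideals_up[OF \<Phi> mem(1), of i' j'] \<open>j < j'\<close> l by simp
      then show False using mem by blast
    qed
  qed
qed

lemma corners_minimal_roots:
  assumes \<Phi>: "\<Phi> \<in> root_ideals l"
  shows "row_corners \<Phi> = fst ` minimal_roots \<Phi>" "col_corners \<Phi> = snd ` minimal_roots \<Phi>"
proof -
  show "row_corners \<Phi> = fst ` minimal_roots \<Phi>"
  proof (intro equalityI subsetI)
    fix i assume "i \<in> row_corners \<Phi>"
    then obtain j where j: "(i, j) \<in> \<Phi>" "(Suc i, j) \<notin> \<Phi>" by (auto simp: row_corners_def)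
    obtain i' j' where m: "(i', j') \<in> minimal_roots \<Phi>" "i \<le> i'" "j' < j"
      using minimal_root_below[OF \<Phi> j(1)] .
    have "\<not> Suc i \<le> i'"
      using root_ideals_up[OF \<Phi>, of i' "Suc j'" "Suc i" j] m j root_idealsD[OF \<Phi> j(1)]
      by (auto simp: minimal_roots_def)
    then have "i' = i" using m by simp
    then show "i \<in> fst ` minimal_roots \<Phi>" using m by force
  qed (auto simp: row_corners_def minimal_roots_def)
  show "col_corners \<Phi> = snd ` minimal_roots \<Phi>"
  proof (intro equalityI subsetI)
    fix j assume "j \<in> col_corners \<Phi>"
    then obtain i where i: "(i, Suc j) \<in> \<Phi>" "(i, j) \<notin> \<Phi>" by (auto simp: col_corners_def)
    obtain i' j' where m: "(i', j') \<in> minimal_roots \<Phi>" "i \<le> i'" "j' < Suc j"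
      using minimal_root_below[OF \<Phi> i(1)] .
    have "\<not> Suc j' \<le> j"
      using root_ideals_up[OF \<Phi>, of i' "Suc j'" i j] m i root_idealsD[OF \<Phi> i(1)]
      by (auto simp: minimal_roots_def)
    then have "j' = j" using m by simp
    then show "j \<in> snd ` minimal_roots \<Phi>" using m by force
  qed (auto simp: col_corners_def minimal_roots_def)
qed

lemma cnt_corners:
  assumes \<Phi>: "\<Phi> \<in> root_ideals l"
  shows "cnt (row_corners \<Phi>) i = card {p \<in> minimal_roots \<Phi>. fst p < i}"
    and "cnt (col_corners \<Phi>) j = card {p \<in> minimal_roots \<Phi>. snd p < j}"
    and "finite (minimal_roots \<Phi>)"
    and "card (row_corners \<Phi>) = card (col_corners \<Phi>)"
proof -
  have same: "p = q" if "p \<in> minimal_roots \<Phi>" "q \<in> minimal_roots \<Phi>" "fst p = fst q \<or> snd p = snd q" for p q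
    using minimal_roots_chain[OF \<Phi>, of "fst p" "snd p" "fst q" "snd q"]
      minimal_roots_chain[OF \<Phi>, of "fst q" "snd q" "fst p" "snd p"] that
    by (auto simp: prod_eq_iff)
  have inj_M: "inj_on fst (minimal_roots \<Phi>)" "inj_on snd (minimal_roots \<Phi>)"
    by (rule inj_onI, rule same, assumption, assumption, simp)+
  note inj = inj_M inj_M[THEN inj_on_subset, OF Collect_restrict]
  have "row_corners \<Phi> \<inter> {..<i} = fst ` {p \<in> minimal_roots \<Phi>. fst p < i}"
    by (auto simp: corners_minimal_roots[OF \<Phi>])
  then show "cnt (row_corners \<Phi>) i = card {p \<in> minimal_roots \<Phi>. fst p < i}"
    by (simp add: card_image inj)
  have "col_corners \<Phi> \<inter> {..<j} = snd ` {p \<in> minimal_roots \<Phi>. snd p < j}"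
    by (auto simp: corners_minimal_roots[OF \<Phi>])
  then show "cnt (col_corners \<Phi>) j = card {p \<in> minimal_roots \<Phi>. snd p < j}"
    by (simp add: card_image inj)
  show "finite (minimal_roots \<Phi>)"
  proof -
    have "finite (row_corners \<Phi>)"
      using corners_subset(1)[OF \<Phi>] by (rule finite_subset) simp
    then show ?thesis
      by (simp add: corners_minimal_roots[OF \<Phi>] finite_image_iff inj)
  qed
  show "card (row_corners \<Phi>) = card (col_corners \<Phi>)"
    by (simp add: corners_minimal_roots[OF \<Phi>] card_image inj)
qed

text \<open>
  By \<open>minimal_roots_chain\<close> the minimal roots with row \<open>< i\<close> and those with lowered column \<open>< j\<close> are
  both initial segments of the same chain. If \<open>(i, j)\<close> is in \<open>\<Phi>\<close>, a minimal root below it belongs to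
  the second segment but not to the first. Conversely a longer second segment contains a minimal
  root of row \<open>\<ge> i\<close>, which lies below \<open>(i, j)\<close>.
\<close>

lemma mem_root_ideal_iff_cnt:
  assumes \<Phi>: "\<Phi> \<in> root_ideals l" and j: "j \<le> l"
  shows "(i, j) \<in> \<Phi> \<longleftrightarrow> cnt (row_corners \<Phi>) i < cnt (col_corners \<Phi>) j"
proof
  let ?M = "minimal_roots \<Phi>"
  note chain = minimal_roots_chain[OF \<Phi>] and fin = cnt_corners(3)[OF \<Phi>]
  {
    assume "(i, j) \<in> \<Phi>"
    then obtain i' j' where m: "(i', j') \<in> ?M" "i \<le> i'" "j' < j"
      using minimal_root_below[OF \<Phi>] by blast
    have "snd p < j" if "p \<in> ?M" "fst p < i" for p
      using chain[of "fst p" "snd p" i' j'] m that by simp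
    then have "{p \<in> ?M. fst p < i} \<subset> {p \<in> ?M. snd p < j}"
      using m by fastforce
    then show "cnt (row_corners \<Phi>) i < cnt (col_corners \<Phi>) j"
      unfolding cnt_corners(1,2)[OF \<Phi>] using fin by (intro psubset_card_mono) auto
  }
  {
    assume lt: "cnt (row_corners \<Phi>) i < cnt (col_corners \<Phi>) j"
    have "\<not> {p \<in> ?M. snd p < j} \<subseteq> {p \<in> ?M. fst p < i}"
    proof
      assume "{p \<in> ?M. snd p < j} \<subseteq> {p \<in> ?M. fst p < i}"
      then have "card {p \<in> ?M. snd p < j} \<le> card {p \<in> ?M. fst p < i}"
        using fin by (intro card_mono) auto
      then show False using lt unfolding cnt_corners(1,2)[OF \<Phi>] by simp
    qed
    then obtain i' j' where "(i', j') \<in> ?M" "j' < j" "i \<le> i'" by force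
    then show "(i, j) \<in> \<Phi>"
      using root_ideals_up[OF \<Phi>, of i' "Suc j'" i j] j by (simp add: minimal_roots_def)
  }
qed

text \<open>
  The height condition of a balanced word is what puts the ideal strictly above the diagonal.
\<close>

lemma word_ideal_mem_root_ideals:
  assumes bal: "balanced step_height xs"
  shows "word_ideal xs \<in> root_ideals (length xs)"
proof -
  let ?R = "fst_positions xs" and ?C = "snd_positions xs"
  have "i < j" if "cnt ?R i < cnt ?C j" for i j
  proof (rule ccontr)
    assume "\<not> i < j"
    then have "cnt ?R j \<le> cnt ?R i" by (intro cnt_mono) simp
    moreover have "cnt ?C j \<le> cnt ?R j" using bal by (simp add: balanced_iff_positions)
    ultimately show False using that by simp
  qed
  moreover have "cnt ?R i' < cnt ?C j'" if "cnt ?R i < cnt ?C j" "i' \<le> i" "j \<le> j'" for i j i' j'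
    using that(1) cnt_mono[OF that(2), of ?R] cnt_mono[OF that(3), of ?C] by linarith
  ultimately show ?thesis
    unfolding root_ideals_def word_ideal_def mem_Collect_eq case_prod_conv
    by (intro conjI allI impI; elim conjE) (blast intro: order_trans less_imp_le)+
qed

text \<open>
  Only at a position \<open>a\<close> with true first component does the count of rows increase, so only there
  can the criterion of \<open>word_ideal\<close> fail on passing from \<open>a\<close> to \<open>Suc a\<close>. There it does fail for a
  column whose count is exactly the increased one, and \<open>cnt_attains\<close> provides this column because
  both counts have the same final value. The second components are treated in the same way.
\<close>

lemma corners_word_ideal:
  assumes bal: "balanced step_height xs"
  shows "row_corners (word_ideal xs) = fst_positions xs"
    and "col_corners (word_ideal xs) = snd_positions xs"
proof -
  let ?l = "length xs" and ?R = "fst_positions xs" and ?C = "snd_positions xs"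
  have tot: "cnt ?R k = cnt ?C k" if "k \<ge> ?l" for k
    using bal that by (simp add: balanced_iff_positions cnt_eq_card[OF positions_subset(1)]
        cnt_eq_card[OF positions_subset(2)])
  show "row_corners (word_ideal xs) = ?R"
  proof (intro equalityI subsetI)
    fix a assume "a \<in> row_corners (word_ideal xs)"
    then obtain j where j: "(a, j) \<in> word_ideal xs" "(Suc a, j) \<notin> word_ideal xs"
      by (auto simp: row_corners_def)
    then have "a < ?l"
      using root_idealsD[OF word_ideal_mem_root_ideals[OF bal] j(1)] by simp
    then have "cnt ?R a < cnt ?R (Suc a)"
      using j by (auto simp: word_ideal_def)
    then show "a \<in> ?R" by (auto simp: cnt_Suc split: if_splits)
  next
    fix a assume a: "a \<in> ?R"
    then have "Suc a \<le> ?l" using positions_subset(1) by fastforce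
    then have "cnt ?R (Suc a) \<le> cnt ?C ?l" using cnt_mono[of "Suc a" ?l ?R] tot[of ?l] by simp
    then obtain j where "j \<le> ?l" "cnt ?C j = cnt ?R (Suc a)" using cnt_attains by blast
    then have "(a, j) \<in> word_ideal xs \<and> (Suc a, j) \<notin> word_ideal xs"
      using a \<open>Suc a \<le> ?l\<close> by (simp add: word_ideal_def cnt_Suc)
    then show "a \<in> row_corners (word_ideal xs)" by (auto simp: row_corners_def)
  qed
  show "col_corners (word_ideal xs) = ?C"
  proof (intro equalityI subsetI)
    fix b assume "b \<in> col_corners (word_ideal xs)"
    then obtain i where "(i, Suc b) \<in> word_ideal xs" "(i, b) \<notin> word_ideal xs"
      by (auto simp: col_corners_def)
    then have "cnt ?C b < cnt ?C (Suc b)" by (auto simp: word_ideal_def)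
    then show "b \<in> ?C" by (auto simp: cnt_Suc split: if_splits)
  next
    fix b assume b: "b \<in> ?C"
    then have "Suc b \<le> ?l" using positions_subset(2) by fastforce
    then have "cnt ?C b \<le> cnt ?R ?l" using cnt_mono[of b ?l ?C] tot[of ?l] by simp
    then obtain i where "i \<le> ?l" "cnt ?R i = cnt ?C b" using cnt_attains by blast
    then have "(i, Suc b) \<in> word_ideal xs \<and> (i, b) \<notin> word_ideal xs"
      using b \<open>Suc b \<le> ?l\<close> by (simp add: word_ideal_def cnt_Suc)
    then show "b \<in> col_corners (word_ideal xs)" by (auto simp: col_corners_def)
  qed
qed

lemma corner_word_word_ideal:
  assumes "balanced step_height xs"
  shows "corner_word (length xs) (word_ideal xs) = xs"
  by (rule nth_equalityI)
    (auto simp: corner_word_def corners_word_ideal[OF assms] fst_positions_def snd_positions_def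
      prod_eq_iff)

text \<open>
  The height after \<open>k\<close> letters is nonnegative because \<open>(k, k)\<close>, not being a root, fails the
  criterion of \<open>mem_root_ideal_iff_cnt\<close>.
\<close>

lemma balanced_corner_word:
  assumes \<Phi>: "\<Phi> \<in> root_ideals l"
  shows "balanced step_height (corner_word l \<Phi>)"
proof -
  have "cnt (col_corners \<Phi>) k \<le> cnt (row_corners \<Phi>) k" for k
  proof (cases "k \<le> l")
    case True
    then show ?thesis
      using mem_root_ideal_iff_cnt[OF \<Phi>, of k k] root_idealsD(1)[OF \<Phi>, of k k] by fastforce
  next
    case False
    then show ?thesis
      using cnt_corners(4)[OF \<Phi>] corners_subset[OF \<Phi>] by (simp add: cnt_eq_card)
  qed
  then show ?thesis
    using cnt_corners(4)[OF \<Phi>] by (simp add: balanced_iff_positions positions_corner_word[OF \<Phi>])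
qed

lemma word_ideal_corner_word:
  assumes \<Phi>: "\<Phi> \<in> root_ideals l"
  shows "word_ideal (corner_word l \<Phi>) = \<Phi>"
proof -
  have len: "length (corner_word l \<Phi>) = l" by (simp add: corner_word_def)
  have "(i, j) \<in> word_ideal (corner_word l \<Phi>) \<longleftrightarrow> (i, j) \<in> \<Phi>" for i j
  proof (cases "i \<le> l \<and> j \<le> l")
    case True
    then show ?thesis
      by (simp add: word_ideal_def positions_corner_word[OF \<Phi>] len mem_root_ideal_iff_cnt[OF \<Phi>])
  next
    case False
    then show ?thesis
      using root_idealsD[OF \<Phi>, of i j] by (auto simp: word_ideal_def len)
  qed
  then show ?thesis by auto
qed

lemma count_list_map_upt: "count_list (map f [0..<l]) y = card {k. k < l \<and> f k = y}"
proof (induction l)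
  case (Suc l)
  have "{k. k < Suc l \<and> f k = y} = (if f l = y then insert l else id) {k. k < l \<and> f k = y}"
    by (auto simp: less_Suc_eq)
  then show ?case using Suc by auto
qed simp

text \<open>
  The indices of the simple roots whose negatives preserve the ideal, see
  \<open>max_simple_supported\<close> below.
\<close>

definition free_indices :: "nat \<Rightarrow> (nat \<times> nat) set \<Rightarrow> nat set" where
  "free_indices l \<Phi> = {k. k < l \<and> k \<notin> row_corners \<Phi> \<and> k \<notin> col_corners \<Phi>}"

lemma count_corner_word: "count_list (corner_word l \<Phi>) (False, False) = card (free_indices l \<Phi>)"
  by (simp add: corner_word_def count_list_map_upt free_indices_def)

lemma bij_corner_word:
  "bij_betw (corner_word l) {\<Phi> \<in> root_ideals l. card (free_indices l \<Phi>) = r}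
     {xs. length xs = l \<and> balanced step_height xs \<and> count_list xs (False, False) = r}"
proof (rule bij_betw_byWitness[where f' = word_ideal])
  have len: "length (corner_word l \<Phi>) = l" for \<Phi> by (simp add: corner_word_def)
  show "\<forall>\<Phi>\<in>{\<Phi> \<in> root_ideals l. card (free_indices l \<Phi>) = r}. word_ideal (corner_word l \<Phi>) = \<Phi>"
    by (simp add: word_ideal_corner_word)
  show "\<forall>xs\<in>{xs. length xs = l \<and> balanced step_height xs \<and> count_list xs (False, False) = r}.
      corner_word l (word_ideal xs) = xs"
    using corner_word_word_ideal by blast
  show "corner_word l ` {\<Phi> \<in> root_ideals l. card (free_indices l \<Phi>) = r}
      \<subseteq> {xs. length xs = l \<and> balanced step_height xs \<and> count_list xs (False, False) = r}"
    by (auto simp: len balanced_corner_word count_corner_word)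
  show "word_ideal ` {xs. length xs = l \<and> balanced step_height xs \<and> count_list xs (False, False) = r}
      \<subseteq> {\<Phi> \<in> root_ideals l. card (free_indices l \<Phi>) = r}"
    using word_ideal_mem_root_ideals
    by (auto simp: count_corner_word[symmetric] corner_word_word_ideal)
qed

section \<open>Roots and standard parabolic subalgebras in terms of matrix entries\<close>

definition unit_mat :: "nat \<Rightarrow> nat \<Rightarrow> nat \<Rightarrow> complex mat" where
  "unit_mat l i j = mat (l + 1) (l + 1) (\<lambda>(a, b). of_bool (a = i \<and> b = j))"

definition diag_mat_of :: "nat \<Rightarrow> (nat \<Rightarrow> complex) \<Rightarrow> complex mat" where
  "diag_mat_of l f = mat (l + 1) (l + 1) (\<lambda>(a, b). if a = b then f a else 0)"

lemma unit_mat_carrier [simp]: "unit_mat l i j \<in> carrier_mat (Suc l) (Suc l)"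
  by (simp add: unit_mat_def)

lemma unit_mat_dim [simp]: "dim_row (unit_mat l i j) = Suc l" "dim_col (unit_mat l i j) = Suc l"
  by (simp_all add: unit_mat_def)

lemma unit_mat_index [simp]:
  "a \<le> l \<Longrightarrow> b \<le> l \<Longrightarrow> unit_mat l i j $$ (a, b) = of_bool (a = i \<and> b = j)"
  by (simp add: unit_mat_def)

lemma diag_mat_of_cartan: "(\<Sum>a\<le>l. f a) = 0 \<Longrightarrow> diag_mat_of l f \<in> cartan l"
  by (auto simp: cartan_def sl_def diag_mat_of_def diagonal_mat_def lessThan_Suc_atMost)

lemma diag_mat_of_index [simp]: "a \<le> l \<Longrightarrow> diag_mat_of l f $$ (a, a) = f a"
  by (simp add: diag_mat_of_def)

lemma cartanD:
  assumes "h \<in> cartan l"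
  shows "h \<in> carrier_mat (Suc l) (Suc l)"
    and "a \<le> l \<Longrightarrow> b \<le> l \<Longrightarrow> a \<noteq> b \<Longrightarrow> h $$ (a, b) = 0"
  using assms by (auto simp: cartan_def sl_def diagonal_mat_def)

lemma bracket_carrier:
  "A \<in> carrier_mat (Suc l) (Suc l) \<Longrightarrow> B \<in> carrier_mat (Suc l) (Suc l)
    \<Longrightarrow> bracket A B \<in> carrier_mat (Suc l) (Suc l)"
  by (auto simp: bracket_def)

lemma bracket_index:
  assumes "A \<in> carrier_mat (Suc l) (Suc l)" "B \<in> carrier_mat (Suc l) (Suc l)" "a \<le> l" "b \<le> l"
  shows "bracket A B $$ (a, b)
    = (\<Sum>c\<le>l. A $$ (a, c) * B $$ (c, b)) - (\<Sum>c\<le>l. B $$ (a, c) * A $$ (c, b))"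
  using assms by (auto simp: bracket_def scalar_prod_def atLeast0LessThan lessThan_Suc_atMost)

lemma bracket_index_nonzeroE:
  assumes "A \<in> carrier_mat (Suc l) (Suc l)" "B \<in> carrier_mat (Suc l) (Suc l)" "a \<le> l" "b \<le> l"
    and "bracket A B $$ (a, b) \<noteq> 0"
  obtains c where "c \<le> l" "A $$ (a, c) \<noteq> 0" "B $$ (c, b) \<noteq> 0"
  | c where "c \<le> l" "B $$ (a, c) \<noteq> 0" "A $$ (c, b) \<noteq> 0"
proof -
  have "(\<Sum>c\<le>l. A $$ (a, c) * B $$ (c, b)) \<noteq> 0 \<or> (\<Sum>c\<le>l. B $$ (a, c) * A $$ (c, b)) \<noteq> 0"
    using assms by (auto simp: bracket_index)
  then show thesis
    using that by (auto elim!: sum.not_neutral_contains_not_neutral)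
qed

lemma bracket_diagonal_index:
  assumes h: "h \<in> cartan l" and X: "X \<in> carrier_mat (Suc l) (Suc l)" and ab: "a \<le> l" "b \<le> l"
  shows "bracket h X $$ (a, b) = (h $$ (a, a) - h $$ (b, b)) * X $$ (a, b)"
proof -
  have "(\<Sum>c\<le>l. h $$ (a, c) * X $$ (c, b)) = (\<Sum>c\<le>l. if c = a then h $$ (a, a) * X $$ (a, b) else 0)"
    using cartanD(2)[OF h] ab by (intro sum.cong) auto
  moreover have "(\<Sum>c\<le>l. X $$ (a, c) * h $$ (c, b)) = (\<Sum>c\<le>l. if c = b then X $$ (a, b) * h $$ (b, b) else 0)"
    using cartanD(2)[OF h] ab by (intro sum.cong) auto
  ultimately show ?thesis
    using ab by (simp add: bracket_index[OF cartanD(1)[OF h] X ab] algebra_simps)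
qed

lemma bracket_unit_index:
  assumes X: "X \<in> carrier_mat (Suc l) (Suc l)" and ab: "a \<le> l" "b \<le> l" and ij: "i \<le> l" "j \<le> l"
  shows "bracket (unit_mat l i j) X $$ (a, b)
    = of_bool (a = i) * X $$ (j, b) - X $$ (a, i) * of_bool (b = j)"
proof -
  have "(\<Sum>c\<le>l. unit_mat l i j $$ (a, c) * X $$ (c, b))
      = (\<Sum>c\<le>l. if c = j then of_bool (a = i) * X $$ (j, b) else 0)"
    using ab by (intro sum.cong) auto
  moreover have "(\<Sum>c\<le>l. X $$ (a, c) * unit_mat l i j $$ (c, b))
      = (\<Sum>c\<le>l. if c = i then X $$ (a, i) * of_bool (b = j) else 0)"
    using ab by (intro sum.cong) auto
  ultimately show ?thesis
    using ab ij by (simp add: bracket_index[OF unit_mat_carrier X])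
qed

lemma root_apply: "h \<in> cartan l \<Longrightarrow> root l i j h = h $$ (i, i) - h $$ (j, j)"
  by (simp add: root_def eps_def)

lemma root_eqI:
  assumes "\<And>h. h \<in> cartan l \<Longrightarrow> h $$ (a, a) - h $$ (b, b) = h $$ (i, i) - h $$ (j, j)"
  shows "root l a b = root l i j"
proof
  fix h show "root l a b h = root l i j h"
    using assms by (cases "h \<in> cartan l") (simp_all add: root_apply, simp add: root_def)
qed

lemma coroot_cartan:
  assumes "a \<noteq> b" "a \<le> l" "b \<le> l"
  shows "diag_mat_of l (\<lambda>k. of_bool (k = a) - of_bool (k = b)) \<in> cartan l"
  by (rule diag_mat_of_cartan)
    (use assms in \<open>simp add: sum_subtractf of_bool_def\<close>)

text \<open>
  Evaluate at the coroot, the diagonal matrix with entries \<open>1\<close> at \<open>a\<close>, \<open>-1\<close> at \<open>b\<close> and \<open>0\<close>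
  elsewhere: the difference of two of its entries is \<open>2\<close> only for the pair \<open>(a, b)\<close>.
\<close>

lemma root_inject:
  assumes eq: "root l a b = root l i j" and "a \<noteq> b" "a \<le> l" "b \<le> l" "i \<le> l" "j \<le> l"
  shows "a = i \<and> b = j"
proof -
  let ?h = "diag_mat_of l (\<lambda>k. of_bool (k = a) - of_bool (k = b))"
  have h: "?h \<in> cartan l" using assms by (intro coroot_cartan) auto
  have "root l a b ?h = 2"
    unfolding root_apply[OF h] using assms by simp
  then have "root l i j ?h = 2" using eq by simp
  then show ?thesis
    unfolding root_apply[OF h] using assms by (auto simp: of_bool_def split: if_splits)
qed

lemma root_mem_pos_roots_iff:
  assumes "a \<noteq> b" "a \<le> l" "b \<le> l"
  shows "root l a b \<in> pos_roots l \<longleftrightarrow> a < b"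
proof
  assume "root l a b \<in> pos_roots l"
  then obtain i j where "root l a b = root l i j" "i < j" "j \<le> l"
    by (auto simp: pos_roots_def)
  then show "a < b" using root_inject[of l a b i j] assms by simp
qed (use assms in \<open>auto simp: pos_roots_def\<close>)

text \<open>
  A Cartan element \<open>h\<close> multiplies the entry \<open>(a, b)\<close> by the value of \<open>root l a b\<close> at \<open>h\<close>, so an
  eigenvector of weight \<open>\<alpha>\<close> vanishes at all positions of other weight. The diagonal has weight
  \<open>0\<close>, which is not a root.
\<close>

lemma root_space_iff:
  assumes \<alpha>: "\<alpha> \<in> roots l"
  shows "y \<in> root_space l \<alpha> \<longleftrightarrow> y \<in> carrier_mat (Suc l) (Suc l) \<and>
    (\<forall>a\<le>l. \<forall>b\<le>l. y $$ (a, b) \<noteq> 0 \<longrightarrow> a \<noteq> b \<and> root l a b = \<alpha>)"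
proof (intro iffI conjI allI impI; (elim conjE)?)
  assume y: "y \<in> root_space l \<alpha>"
  then show car: "y \<in> carrier_mat (Suc l) (Suc l)" by (simp add: root_space_def sl_def)
  obtain i j where ij: "\<alpha> = root l i j" "i \<le> l" "j \<le> l" "i \<noteq> j"
    using \<alpha> by (auto simp: roots_def)
  fix a b assume ab: "a \<le> l" "b \<le> l" "y $$ (a, b) \<noteq> 0"
  have "h $$ (a, a) - h $$ (b, b) = h $$ (i, i) - h $$ (j, j)" if h: "h \<in> cartan l" for h
  proof -
    have "bracket h y = \<alpha> h \<cdot>\<^sub>m y" using y h by (simp add: root_space_def)
    then have "bracket h y $$ (a, b) = \<alpha> h * y $$ (a, b)" using ab car by simp
    then show ?thesis
      using ab by (simp add: bracket_diagonal_index[OF h car] ij(1) root_apply[OF h])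
  qed
  then show eq: "root l a b = \<alpha>" unfolding ij(1) by (rule root_eqI)
  show "a \<noteq> b"
    using root_inject[of l i j a b] eq ij ab by auto
next
  assume car: "y \<in> carrier_mat (Suc l) (Suc l)"
    and supp: "\<forall>a\<le>l. \<forall>b\<le>l. y $$ (a, b) \<noteq> 0 \<longrightarrow> a \<noteq> b \<and> root l a b = \<alpha>"
  have "y $$ (a, a) = 0" if "a \<le> l" for a using supp that by blast
  then have "y \<in> sl l"
    using car by (simp add: sl_def)
  moreover have "bracket h y = \<alpha> h \<cdot>\<^sub>m y" if h: "h \<in> cartan l" for h
  proof (rule eq_matI)
    fix a b assume "a < dim_row (\<alpha> h \<cdot>\<^sub>m y)" "b < dim_col (\<alpha> h \<cdot>\<^sub>m y)"
    then have ab: "a \<le> l" "b \<le> l" using car by auto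
    show "bracket h y $$ (a, b) = (\<alpha> h \<cdot>\<^sub>m y) $$ (a, b)"
    proof (cases "y $$ (a, b) = 0")
      case False
      then have "\<alpha> = root l a b" using supp ab by auto
      then show ?thesis using car ab
        by (simp add: bracket_diagonal_index[OF h car] root_apply[OF h])
    qed (use car ab in \<open>simp add: bracket_diagonal_index[OF h car]\<close>)
  qed (use car bracket_carrier[OF cartanD(1)[OF h] car] in auto)
  ultimately show "y \<in> root_space l \<alpha>" by (simp add: root_space_def)
qed

lemma finsum_mat:
  assumes "finite S" "\<And>\<alpha>. \<alpha> \<in> S \<Longrightarrow> x \<alpha> \<in> carrier_mat m n"
  shows "finsum (module_mat TYPE(complex) m n) x S \<in> carrier_mat m n
    \<and> (\<forall>i<m. \<forall>j<n. finsum (module_mat TYPE(complex) m n) x S $$ (i, j) = (\<Sum>\<alpha>\<in>S. x \<alpha> $$ (i, j)))"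
  using assms
proof (induction S rule: finite_induct)
  interpret abelian_group "module_mat TYPE(complex) m n" by (rule abelian_group_mat)
  case empty
  show ?case by (simp add: module_mat_simps)
next
  interpret abelian_group "module_mat TYPE(complex) m n" by (rule abelian_group_mat)
  case (insert \<alpha> S)
  have "finsum (module_mat TYPE(complex) m n) x (insert \<alpha> S)
      = x \<alpha> + finsum (module_mat TYPE(complex) m n) x S"
    using insert.hyps insert.prems
    by (subst finsum_insert) (auto simp: module_mat_simps)
  moreover have F: "finsum (module_mat TYPE(complex) m n) x S \<in> carrier_mat m n"
    "\<forall>i<m. \<forall>j<n. finsum (module_mat TYPE(complex) m n) x S $$ (i, j) = (\<Sum>\<alpha>\<in>S. x \<alpha> $$ (i, j))"
    using insert by auto
  ultimately show ?case using insert.hyps insert.prems carrier_matD[OF F(1)] by simp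
qed

lemma roots_gen_subset: "roots_gen l I \<union> pos_roots l \<subseteq> roots l"
  by (force simp: roots_gen_def pos_roots_def roots_def)

lemma finite_roots: "finite (roots l)"
proof -
  have "roots l \<subseteq> case_prod (root l) ` ({..l} \<times> {..l})"
    by (auto simp: roots_def)
  then show ?thesis by (rule finite_subset) simp
qed

text \<open>
  This replaces the sum of root spaces by a condition on matrix positions, the form in which
  parabolic subalgebras are used from here on.
\<close>

lemma parabolic_iff:
  "A \<in> parabolic l I \<longleftrightarrow> A \<in> sl l \<and>
    (\<forall>a\<le>l. \<forall>b\<le>l. A $$ (a, b) \<noteq> 0 \<longrightarrow> a = b \<or> root l a b \<in> roots_gen l I \<union> pos_roots l)"
proof -
  define S where "S = roots_gen l I \<union> pos_roots l"
  let ?sum = "\<lambda>x. finsum (module_mat TYPE(complex) (l + 1) (l + 1)) x S"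
  have S: "S \<subseteq> roots l" unfolding S_def by (rule roots_gen_subset)
  then have finS: "finite S" using finite_roots finite_subset by blast
  have rs: "x \<in> carrier_mat (l + 1) (l + 1)"
    and rs_index: "a \<le> l \<Longrightarrow> b \<le> l \<Longrightarrow> x $$ (a, b) \<noteq> 0 \<Longrightarrow> a \<noteq> b \<and> root l a b = \<alpha>"
    if "\<alpha> \<in> S" "x \<in> root_space l \<alpha>" for \<alpha> x a b
    using that S root_space_iff[of \<alpha> l x] by auto
  have "A \<in> sl l \<and> (\<forall>a\<le>l. \<forall>b\<le>l. A $$ (a, b) \<noteq> 0 \<longrightarrow> a = b \<or> root l a b \<in> S)"
    if "A = h + ?sum x" and h: "h \<in> cartan l" and x: "\<forall>\<alpha>\<in>S. x \<alpha> \<in> root_space l \<alpha>" for h x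
  proof -
    have sum: "?sum x \<in> carrier_mat (l + 1) (l + 1)"
      "\<And>i j. i \<le> l \<Longrightarrow> j \<le> l \<Longrightarrow> ?sum x $$ (i, j) = (\<Sum>\<alpha>\<in>S. x \<alpha> $$ (i, j))"
      using finsum_mat[of S x "l + 1" "l + 1"] finS rs x by auto
    have car: "A \<in> carrier_mat (l + 1) (l + 1)"
      using that cartanD(1)[OF h] sum by simp
    have index: "A $$ (a, b) = h $$ (a, b) + (\<Sum>\<alpha>\<in>S. x \<alpha> $$ (a, b))" if "a \<le> l" "b \<le> l" for a b
      using that \<open>A = _\<close> sum cartanD(1)[OF h] by simp
    have "x \<alpha> $$ (a, a) = 0" if "\<alpha> \<in> S" "a \<le> l" for \<alpha> a
      using rs_index[of \<alpha> "x \<alpha>" a a] that x by auto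
    then have "A $$ (a, a) = h $$ (a, a)" if "a \<le> l" for a
      using that by (simp add: index)
    then have "A \<in> sl l"
      using car h by (simp add: sl_def cartan_def)
    moreover have "a = b \<or> root l a b \<in> S" if "a \<le> l" "b \<le> l" "A $$ (a, b) \<noteq> 0" for a b
    proof (rule disjCI)
      assume "root l a b \<notin> S"
      then have "x \<alpha> $$ (a, b) = 0" if "\<alpha> \<in> S" for \<alpha>
        using rs_index[of \<alpha> "x \<alpha>" a b] that x \<open>a \<le> l\<close> \<open>b \<le> l\<close> by auto
      then have "h $$ (a, b) \<noteq> 0" using that by (simp add: index)
      then show "a = b" using cartanD(2)[OF h] that by auto
    qed
    ultimately show ?thesis by blast
  qed
  moreover have "\<exists>h x. A = h + ?sum x \<and> h \<in> cartan l \<and> (\<forall>\<alpha>\<in>S. x \<alpha> \<in> root_space l \<alpha>)"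
    if A: "A \<in> sl l" and supp: "\<forall>a\<le>l. \<forall>b\<le>l. A $$ (a, b) \<noteq> 0 \<longrightarrow> a = b \<or> root l a b \<in> S"
  proof -
    define h where "h = diag_mat_of l (\<lambda>a. A $$ (a, a))"
    \<comment> \<open>The root components of \<open>A\<close>: each off-diagonal entry goes to the component of its own root.\<close>
    define x where "x \<alpha> = mat (l + 1) (l + 1) (\<lambda>(a, b). if a \<noteq> b \<and> root l a b = \<alpha> then A $$ (a, b) else 0)"
      for \<alpha>
    have h: "h \<in> cartan l"
      unfolding h_def using A by (intro diag_mat_of_cartan) (simp add: sl_def lessThan_Suc_atMost)
    have x: "x \<alpha> \<in> root_space l \<alpha>" if "\<alpha> \<in> S" for \<alpha>
      using that S by (subst root_space_iff) (auto simp: x_def split: if_splits)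
    have sum: "?sum x \<in> carrier_mat (l + 1) (l + 1)"
      "\<And>i j. i \<le> l \<Longrightarrow> j \<le> l \<Longrightarrow> ?sum x $$ (i, j) = (\<Sum>\<alpha>\<in>S. x \<alpha> $$ (i, j))"
      using finsum_mat[of S x "l + 1" "l + 1"] finS by (auto simp: x_def)
    have "A = h + ?sum x"
    proof (rule eq_matI)
      fix a b assume "a < dim_row (h + ?sum x)" "b < dim_col (h + ?sum x)"
      then have ab: "a \<le> l" "b \<le> l" using sum by auto
      have "(\<Sum>\<alpha>\<in>S. x \<alpha> $$ (a, b)) = (\<Sum>\<alpha>\<in>S. if \<alpha> = root l a b then of_bool (a \<noteq> b) * A $$ (a, b) else 0)"
        using ab by (intro sum.cong) (auto simp: x_def)
      also have "\<dots> = of_bool (a \<noteq> b) * A $$ (a, b)"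
        using supp ab finS by (cases "A $$ (a, b) = 0") (auto simp: of_bool_def)
      finally show "A $$ (a, b) = (h + ?sum x) $$ (a, b)"
        using ab sum by (auto simp: h_def diag_mat_of_def)
    qed (use A sum in \<open>auto simp: sl_def\<close>)
    then show ?thesis using h x by blast
  qed
  ultimately show ?thesis
    unfolding parabolic_def S_def[symmetric] by blast
qed

lemma int_span_empty: "int_span l {} = {restrict (\<lambda>_. 0) (cartan l)}"
  by (auto simp: int_span_def)

lemma roots_gen_empty: "roots_gen l {} = {}"
proof -
  have "restrict (\<lambda>_. 0) (cartan l) \<noteq> root l i j" if "i \<le> l" "j \<le> l" "i \<noteq> j" for i j
  proof -
    have "restrict (\<lambda>_. 0) (cartan l) = root l i i" by (simp add: root_def)
    then show ?thesis using root_inject[of l i j i i] that by auto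
  qed
  then show ?thesis by (auto simp: roots_gen_def int_span_empty roots_def)
qed

lemma borel_iff:
  "A \<in> parabolic l {} \<longleftrightarrow> A \<in> sl l \<and> (\<forall>a\<le>l. \<forall>b\<le>l. A $$ (a, b) \<noteq> 0 \<longrightarrow> a \<le> b)"
proof -
  have "a = b \<or> root l a b \<in> roots_gen l {} \<union> pos_roots l \<longleftrightarrow> a \<le> b" if "a \<le> l" "b \<le> l" for a b
    using that root_mem_pos_roots_iff[of a b l] by (cases "a = b") (auto simp: roots_gen_empty)
  then show ?thesis unfolding parabolic_iff by blast
qed

text \<open>
  The coefficient of the simple root of index \<open>k\<close> in a negative root from row \<open>a\<close> to column
  \<open>b \<le> k < a\<close> cannot vanish. It is detected by a fundamental coweight, which is killed by all
  other simple roots.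
\<close>

lemma simple_root_mem_of_root_mem_int_span:
  assumes I: "I \<subseteq> simple_roots l" and mem: "root l a b \<in> int_span l I"
    and k: "b \<le> k" "k < a" "a \<le> l"
  shows "simple_root l k \<in> I"
proof (rule ccontr)
  assume notin: "simple_root l k \<notin> I"
  \<comment> \<open>The multiple by \<open>l + 1\<close> of the fundamental coweight of index \<open>k\<close>.\<close>
  define f :: "nat \<Rightarrow> complex" where "f m = (if m \<le> k then of_nat (l - k) else - of_nat (k + 1))" for m
  have "(\<Sum>m\<le>l. f m) = (\<Sum>m\<in>{..k}. f m) + (\<Sum>m\<in>{k<..l}. f m)"
    using k by (subst sum.union_disjoint[symmetric]) (auto intro!: sum.cong)
  also have "\<dots> = 0" by (simp add: f_def algebra_simps)
  finally have h: "diag_mat_of l f \<in> cartan l" by (rule diag_mat_of_cartan)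
  obtain c where "root l a b = (\<lambda>h\<in>cartan l. \<Sum>\<alpha>\<in>I. of_int (c \<alpha>) * \<alpha> h)"
    using mem by (auto simp: int_span_def)
  then have "root l a b (diag_mat_of l f) = (\<Sum>\<alpha>\<in>I. of_int (c \<alpha>) * \<alpha> (diag_mat_of l f))"
    using h by simp
  also have "\<dots> = 0"
  proof (rule sum.neutral, rule ballI)
    fix \<alpha> assume "\<alpha> \<in> I"
    then obtain m where m: "\<alpha> = simple_root l m" "m < l" "m \<noteq> k"
      using I notin by (auto simp: simple_roots_def)
    then have "\<alpha> (diag_mat_of l f) = 0"
      unfolding m simple_root_def root_apply[OF h] using m by (auto simp: f_def)
    then show "of_int (c \<alpha>) * \<alpha> (diag_mat_of l f) = 0" by simp
  qed
  finally have "f a - f b = 0"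
    unfolding root_apply[OF h] using k by simp
  moreover have "f b - f a = of_nat (Suc l)"
    using k by (simp add: f_def of_nat_diff)
  ultimately have "of_nat (Suc l) = (0 :: complex)" by simp
  then show False unfolding of_nat_eq_0_iff by simp
qed

lemma neg_simple_root_mem_roots_gen:
  assumes I: "I \<subseteq> simple_roots l" and k: "simple_root l k \<in> I" "k < l"
  shows "root l (Suc k) k \<in> roots_gen l I"
proof -
  have "finite (simple_roots l)" by (auto simp: simple_roots_def)
  then have fin: "finite I" using I finite_subset by blast
  define c :: "_ \<Rightarrow> int" where "c \<alpha> = - of_bool (\<alpha> = simple_root l k)" for \<alpha>
  have "root l (Suc k) k = (\<lambda>h\<in>cartan l. \<Sum>\<alpha>\<in>I. of_int (c \<alpha>) * \<alpha> h)"
  proof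
    fix h
    have "(\<Sum>\<alpha>\<in>I. of_int (c \<alpha>) * \<alpha> h) = (\<Sum>\<alpha>\<in>I. if \<alpha> = simple_root l k then - simple_root l k h else 0)"
      by (intro sum.cong) (auto simp: c_def)
    also have "\<dots> = - simple_root l k h" using fin k by simp
    finally show "root l (Suc k) k h = (\<lambda>h\<in>cartan l. \<Sum>\<alpha>\<in>I. of_int (c \<alpha>) * \<alpha> h) h"
      by (cases "h \<in> cartan l") (simp_all add: simple_root_def root_apply, simp add: root_def)
  qed
  then have "root l (Suc k) k \<in> int_span l I" by (auto simp: int_span_def)
  moreover have "root l (Suc k) k \<in> roots l"
    unfolding roots_def using k by (intro CollectI exI[of _ "Suc k"] exI[of _ k]) simp
  ultimately show ?thesis by (simp add: roots_gen_def)
qed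

section \<open>Ad-nilpotent ideals and their maximal parabolics\<close>

definition supported :: "nat \<Rightarrow> (nat \<times> nat) set \<Rightarrow> complex mat set" where
  "supported l \<Phi> = {X \<in> carrier_mat (l + 1) (l + 1).
     \<forall>a\<le>l. \<forall>b\<le>l. X $$ (a, b) \<noteq> 0 \<longrightarrow> (a, b) \<in> \<Phi>}"

lemma supportedD:
  assumes "X \<in> supported l \<Phi>"
  shows "X \<in> carrier_mat (Suc l) (Suc l)"
    and "a \<le> l \<Longrightarrow> b \<le> l \<Longrightarrow> X $$ (a, b) \<noteq> 0 \<Longrightarrow> (a, b) \<in> \<Phi>"
  using assms by (auto simp: supported_def)

lemma unit_mat_mem_supported_iff:
  "a \<le> l \<Longrightarrow> b \<le> l \<Longrightarrow> unit_mat l a b \<in> supported l \<Phi> \<longleftrightarrow> (a, b) \<in> \<Phi>"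
  by (auto simp: supported_def)

lemma inj_on_supported: "inj_on (supported l) (root_ideals l)"
proof (rule inj_onI)
  fix \<Phi> \<Psi> assume \<Phi>: "\<Phi> \<in> root_ideals l" and \<Psi>: "\<Psi> \<in> root_ideals l"
    and eq: "supported l \<Phi> = supported l \<Psi>"
  have "(a, b) \<in> \<Phi> \<longleftrightarrow> (a, b) \<in> \<Psi>" for a b
  proof (cases "a \<le> l \<and> b \<le> l")
    case True
    then show ?thesis using eq unit_mat_mem_supported_iff by blast
  next
    case False
    then show ?thesis using root_idealsD[OF \<Phi>, of a b] root_idealsD[OF \<Psi>, of a b] by auto
  qed
  then show "\<Phi> = \<Psi>" by auto
qed

lemma lin_subspace_supported: "lin_subspace l (supported l \<Phi>)"
proof -
  have "x + y \<in> supported l \<Phi>" if "x \<in> supported l \<Phi>" "y \<in> supported l \<Phi>" for x y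
  proof -
    note x = that(1) and y = that(2)
    note car = supportedD(1)[OF x] supportedD(1)[OF y]
    have "(a, b) \<in> \<Phi>" if "a \<le> l" "b \<le> l" "(x + y) $$ (a, b) \<noteq> 0" for a b
    proof -
      have "x $$ (a, b) \<noteq> 0 \<or> y $$ (a, b) \<noteq> 0" using that car by auto
      then show ?thesis
        using that supportedD(2)[OF x] supportedD(2)[OF y] by blast
    qed
    then show ?thesis using car by (simp add: supported_def)
  qed
  moreover have "c \<cdot>\<^sub>m x \<in> supported l \<Phi>" if "x \<in> supported l \<Phi>" for c x
    using that by (auto simp: supported_def)
  moreover have "0\<^sub>m (l + 1) (l + 1) \<in> supported l \<Phi>" "supported l \<Phi> \<subseteq> carrier_mat (l + 1) (l + 1)"
    by (auto simp: supported_def)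
  ultimately show ?thesis
    unfolding lin_subspace_def by blast
qed

lemma mem_lin_subspace_if_unit_mats:
  assumes N: "lin_subspace l N" and X: "X \<in> carrier_mat (Suc l) (Suc l)"
    and unit: "\<And>a b. a \<le> l \<Longrightarrow> b \<le> l \<Longrightarrow> X $$ (a, b) \<noteq> 0 \<Longrightarrow> unit_mat l a b \<in> N"
  shows "X \<in> N"
proof -
  \<comment> \<open>The matrix \<open>X\<close> cut down to the positions in \<open>S\<close>, built up position by position.\<close>
  define R where "R S = mat (l + 1) (l + 1) (\<lambda>p. if p \<in> S then X $$ p else 0)" for S
  have "R S \<in> N" if "finite S" "S \<subseteq> {..l} \<times> {..l}" for S
    using that
  proof (induction S rule: finite_induct)
    case empty
    have "R {} = 0\<^sub>m (l + 1) (l + 1)" by (rule eq_matI) (auto simp: R_def)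
    then show ?case using N by (simp add: lin_subspace_def)
  next
    case (insert p S)
    obtain a b where p: "p = (a, b)" by (cases p)
    have R: "R (insert p S) = R S + X $$ p \<cdot>\<^sub>m unit_mat l a b"
      by (rule eq_matI) (use insert.hyps p in \<open>auto simp: R_def unit_mat_def\<close>)
    have IH: "R S \<in> N" using insert by simp
    show ?case
    proof (cases "X $$ p = 0")
      case True
      then have "R (insert p S) = R S"
        by (intro eq_matI) (auto simp: R_def)
      then show ?thesis using IH by simp
    next
      case False
      then have "unit_mat l a b \<in> N" using unit insert.prems p by auto
      then show ?thesis using N IH unfolding R lin_subspace_def by blast
    qed
  qed
  then have "R ({..l} \<times> {..l}) \<in> N" by simp
  moreover have "R ({..l} \<times> {..l}) = X"
    by (rule eq_matI) (use X in \<open>auto simp: R_def\<close>)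
  ultimately show ?thesis by simp
qed

text \<open>
  Bracketing with a strictly upper triangular matrix moves the support of \<open>y\<close> by at least one
  diagonal to the upper right, and there are only \<open>2 * l + 1\<close> diagonals.
\<close>

lemma ad_nilpotent_on_strictly_upper:
  assumes X: "X \<in> carrier_mat (Suc l) (Suc l)"
    and upper: "\<And>a b. a \<le> l \<Longrightarrow> b \<le> l \<Longrightarrow> X $$ (a, b) \<noteq> 0 \<Longrightarrow> a < b"
    and P: "P \<subseteq> carrier_mat (Suc l) (Suc l)"
  shows "ad_nilpotent_on l P X"
  unfolding ad_nilpotent_on_def
proof (intro exI ballI)
  fix y assume "y \<in> P"
  then have y: "y \<in> carrier_mat (Suc l) (Suc l)" using P by blast
  have "(bracket X ^^ k) y \<in> carrier_mat (Suc l) (Suc l)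
      \<and> (\<forall>a\<le>l. \<forall>b\<le>l. (bracket X ^^ k) y $$ (a, b) \<noteq> 0 \<longrightarrow> k + a \<le> l + b)" for k
  proof (induction k)
    case (Suc k)
    let ?Z = "(bracket X ^^ k) y"
    have Z: "?Z \<in> carrier_mat (Suc l) (Suc l)"
      and shift: "\<And>a b. a \<le> l \<Longrightarrow> b \<le> l \<Longrightarrow> ?Z $$ (a, b) \<noteq> 0 \<Longrightarrow> k + a \<le> l + b"
      using Suc by auto
    have "Suc k + a \<le> l + b" if ab: "a \<le> l" "b \<le> l" and nz: "bracket X ?Z $$ (a, b) \<noteq> 0" for a b
      using X Z ab nz
    proof (cases rule: bracket_index_nonzeroE)
      case (1 c)
      then show ?thesis using upper[of a c] shift[of c b] ab by simp
    next
      case (2 c)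
      then show ?thesis using upper[of c b] shift[of a c] ab by simp
    qed
    then show ?case using bracket_carrier[OF X Z] by simp
  qed (use y in auto)
  from this[of "2 * l + 1"]
  have car: "(bracket X ^^ (2 * l + 1)) y \<in> carrier_mat (Suc l) (Suc l)"
    and zero: "\<forall>a\<le>l. \<forall>b\<le>l. (bracket X ^^ (2 * l + 1)) y $$ (a, b) \<noteq> 0 \<longrightarrow> 2 * l + 1 + a \<le> l + b"
    by blast+
  show "(bracket X ^^ (2 * l + 1)) y = 0\<^sub>m (l + 1) (l + 1)"
  proof (rule eq_matI)
    fix a b assume "a < dim_row (0\<^sub>m (l + 1) (l + 1))" "b < dim_col (0\<^sub>m (l + 1) (l + 1))"
    then have ab: "a \<le> l" "b \<le> l" by auto
    then have "\<not> 2 * l + 1 + a \<le> l + b" by simp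
    then have "(bracket X ^^ (2 * l + 1)) y $$ (a, b) = 0" using zero ab by blast
    then show "(bracket X ^^ (2 * l + 1)) y $$ (a, b) = 0\<^sub>m (l + 1) (l + 1) $$ (a, b)"
      using ab by (simp del: funpow.simps)
  qed (use carrier_matD[OF car] in \<open>simp_all del: funpow.simps\<close>)
qed

text \<open>
  For \<open>i < j\<close>, applying \<open>ad X\<close> repeatedly to the matrix unit at \<open>(i, j)\<close> yields matrices
  supported weakly above and to the right of \<open>(i, j)\<close>, whose entry at \<open>(i, j)\<close> is multiplied by
  \<open>X $$ (i, i) - X $$ (j, j)\<close> each time. Nilpotency thus makes the diagonal constant, and the trace
  makes it zero.
\<close>

lemma ad_nilpotent_diagonal_zero:
  assumes X: "X \<in> parabolic l {}" and nil: "ad_nilpotent_on l (parabolic l {}) X" and i: "i \<le> l"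
  shows "X $$ (i, i) = 0"
proof -
  have car: "X \<in> carrier_mat (Suc l) (Suc l)" and tr: "(\<Sum>i\<le>l. X $$ (i, i)) = 0"
    and upper: "\<And>a b. a \<le> l \<Longrightarrow> b \<le> l \<Longrightarrow> X $$ (a, b) \<noteq> 0 \<Longrightarrow> a \<le> b"
    using X by (auto simp: borel_iff sl_def lessThan_Suc_atMost)
  obtain n where n: "\<And>y. y \<in> parabolic l {} \<Longrightarrow> (bracket X ^^ n) y = 0\<^sub>m (l + 1) (l + 1)"
    using nil by (auto simp: ad_nilpotent_on_def)
  have eq: "X $$ (i, i) = X $$ (j, j)" if ij: "i < j" "j \<le> l" for i j
  proof -
    let ?Z = "\<lambda>k. (bracket X ^^ k) (unit_mat l i j)"
    have "?Z k \<in> carrier_mat (Suc l) (Suc l)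
        \<and> (\<forall>a\<le>l. \<forall>b\<le>l. ?Z k $$ (a, b) \<noteq> 0 \<longrightarrow> a \<le> i \<and> j \<le> b)
        \<and> ?Z k $$ (i, j) = (X $$ (i, i) - X $$ (j, j)) ^ k" for k
    proof (induction k)
      case (Suc k)
      have Z: "?Z k \<in> carrier_mat (Suc l) (Suc l)"
        and supp: "\<And>a b. a \<le> l \<Longrightarrow> b \<le> l \<Longrightarrow> ?Z k $$ (a, b) \<noteq> 0 \<Longrightarrow> a \<le> i \<and> j \<le> b"
        and val: "?Z k $$ (i, j) = (X $$ (i, i) - X $$ (j, j)) ^ k"
        using Suc by auto
      have "a \<le> i \<and> j \<le> b" if ab: "a \<le> l" "b \<le> l" and nz: "bracket X (?Z k) $$ (a, b) \<noteq> 0" for a b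
        using car Z ab nz
      proof (cases rule: bracket_index_nonzeroE)
        case (1 c)
        then show ?thesis using upper[of a c] supp[of c b] ab by simp
      next
        case (2 c)
        then show ?thesis using upper[of c b] supp[of a c] ab by simp
      qed
      moreover have "bracket X (?Z k) $$ (i, j) = (X $$ (i, i) - X $$ (j, j)) ^ Suc k"
      proof -
        have "X $$ (i, c) * ?Z k $$ (c, j) = (if c = i then X $$ (i, i) * ?Z k $$ (i, j) else 0)"
          if "c \<le> l" for c
        proof (cases "X $$ (i, c) = 0 \<or> ?Z k $$ (c, j) = 0")
          case False
          then have "c = i" using upper[of i c] supp[of c j] ij that by simp
          then show ?thesis by simp
        qed auto
        then have "(\<Sum>c\<le>l. X $$ (i, c) * ?Z k $$ (c, j))
            = (\<Sum>c\<le>l. if c = i then X $$ (i, i) * ?Z k $$ (i, j) else 0)"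
          by (intro sum.cong) auto
        moreover have "?Z k $$ (i, c) * X $$ (c, j) = (if c = j then ?Z k $$ (i, j) * X $$ (j, j) else 0)"
          if "c \<le> l" for c
        proof (cases "?Z k $$ (i, c) = 0 \<or> X $$ (c, j) = 0")
          case False
          then have "c = j" using upper[of c j] supp[of i c] ij that by simp
          then show ?thesis by simp
        qed auto
        then have "(\<Sum>c\<le>l. ?Z k $$ (i, c) * X $$ (c, j))
            = (\<Sum>c\<le>l. if c = j then ?Z k $$ (i, j) * X $$ (j, j) else 0)"
          by (intro sum.cong) auto
        ultimately show ?thesis
          using ij by (simp add: bracket_index[OF car Z] val algebra_simps)
      qed
      ultimately show ?case using bracket_carrier[OF car Z] by simp
    qed (use ij in auto)
    then have "?Z n $$ (i, j) = (X $$ (i, i) - X $$ (j, j)) ^ n" by blast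
    moreover have "unit_mat l i j \<in> parabolic l {}"
      using ij by (auto simp: borel_iff sl_def)
    ultimately have "(X $$ (i, i) - X $$ (j, j)) ^ n = 0"
      using n ij by simp
    then show ?thesis by simp
  qed
  have const: "X $$ (j, j) = X $$ (0, 0)" if "j \<le> l" for j
    using eq[of 0 j] that by (cases "j = 0") auto
  have "(\<Sum>j\<le>l. X $$ (j, j)) = (\<Sum>j\<le>l. X $$ (0, 0))"
    by (rule sum.cong) (use const in blast)+
  then have "of_nat (Suc l) * X $$ (0, 0) = 0" unfolding tr by simp
  then have "X $$ (0, 0) = 0"
    unfolding mult_eq_0_iff of_nat_eq_0_iff by simp
  then show ?thesis unfolding const[OF i] .
qed

lemma cartan_subset_parabolic: "cartan l \<subseteq> parabolic l I"
  using cartanD(2) by (auto simp: parabolic_iff cartan_def)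

text \<open>
  Matrix units are isolated by the torus. Adding a scalar matrix makes the diagonal matrix unit
  at \<open>c\<close> traceless without changing its bracket, which off the diagonal keeps row \<open>c\<close>, negates
  column \<open>c\<close> and kills the rest, and kills the diagonal. Doing this for \<open>a\<close>
  and for \<open>b\<close> leaves only the positions \<open>(a, b)\<close> and \<open>(b, a)\<close>, and the second vanishes in an upper triangular matrix.
\<close>

lemma unit_mat_mem_if_index_nonzero:
  assumes N: "lie_ideal l (parabolic l {}) N" and X: "X \<in> N"
    and ab: "a < b" "b \<le> l" and nz: "X $$ (a, b) \<noteq> 0"
  shows "unit_mat l a b \<in> N"
proof -
  \<comment> \<open>The diagonal matrix unit at \<open>c\<close>, made traceless by a scalar matrix.\<close>
  define h where "h c = diag_mat_of l (\<lambda>k. of_bool (k = c) - 1 / of_nat (Suc l))" for c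
  have h: "h c \<in> cartan l" if "c \<le> l" for c
  proof -
    have "(\<Sum>k\<le>l. of_bool (k = c) :: complex) = 1"
      using that by (simp add: of_bool_def)
    then show ?thesis
      unfolding h_def by (intro diag_mat_of_cartan) (simp add: sum_subtractf del: of_nat_Suc)
  qed
  have index: "bracket (h c) Y $$ (i, j) = (of_bool (i = c) - of_bool (j = c)) * Y $$ (i, j)"
    if "c \<le> l" "Y \<in> carrier_mat (Suc l) (Suc l)" "i \<le> l" "j \<le> l" for c Y i j
    using bracket_diagonal_index[OF h[OF that(1)] that(2-4)] that(3,4) by (simp add: h_def)
  have closed: "bracket (h c) Y \<in> N" if "Y \<in> N" "c \<le> l" for c Y
    using N that(1) h[OF that(2)] cartan_subset_parabolic[of l "{}"]
    unfolding lie_ideal_def by blast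
  have car: "Y \<in> carrier_mat (Suc l) (Suc l)" if "Y \<in> N" for Y
    using N that by (auto simp: lie_ideal_def lin_subspace_def)
  define Y where "Y = bracket (h b) (bracket (h a) X)"
  have Y: "Y \<in> N" unfolding Y_def using closed X ab by simp
  have lower: "X $$ (b, a) = 0"
  proof -
    have "X \<in> parabolic l {}" using N X by (auto simp: lie_ideal_def)
    then have "\<forall>i\<le>l. \<forall>j\<le>l. X $$ (i, j) \<noteq> 0 \<longrightarrow> i \<le> j" by (simp add: borel_iff)
    moreover have "a \<le> l" "\<not> b \<le> a" using ab by auto
    ultimately show ?thesis using ab by blast
  qed
  have "unit_mat l a b = (- 1 / X $$ (a, b)) \<cdot>\<^sub>m Y"
  proof (rule eq_matI)
    fix i j assume "i < dim_row ((- 1 / X $$ (a, b)) \<cdot>\<^sub>m Y)" "j < dim_col ((- 1 / X $$ (a, b)) \<cdot>\<^sub>m Y)"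
    then have ij: "i \<le> l" "j \<le> l" using car[OF Y] by auto
    have "Y $$ (i, j) = (of_bool (i = b) - of_bool (j = b)) * (of_bool (i = a) - of_bool (j = a)) * X $$ (i, j)"
      unfolding Y_def using ab ij X closed car by (simp add: index)
    also have "\<dots> = - of_bool (i = a \<and> j = b) * X $$ (a, b)"
      using lower ab by auto
    finally show "unit_mat l a b $$ (i, j) = ((- 1 / X $$ (a, b)) \<cdot>\<^sub>m Y) $$ (i, j)"
      using ij nz car[OF Y] by simp
  qed (use car[OF Y] in auto)
  then show ?thesis
    using N Y by (auto simp: lie_ideal_def lin_subspace_def)
qed

text \<open>
  Without a corner in the rows \<open>b, \<dots>, a - 1\<close>, an element of \<open>\<Phi>\<close> can be moved down from row
  \<open>b\<close> to row \<open>a\<close>; the next lemma moves columns to the left.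
\<close>

lemma free_indices_row_step:
  assumes "b \<le> a" "(b, c) \<in> \<Phi>" and free: "\<And>k. b \<le> k \<Longrightarrow> k < a \<Longrightarrow> k \<in> free_indices l \<Phi>"
  shows "(a, c) \<in> \<Phi>"
  using assms(1) free
proof (induction a rule: dec_induct)
  case (step k)
  then have "(k, c) \<in> \<Phi>" "k \<notin> row_corners \<Phi>" by (auto simp: free_indices_def)
  then show ?case by (auto simp: row_corners_def)
qed (rule assms)

lemma free_indices_col_step:
  assumes "b \<le> c" "(a, c) \<in> \<Phi>" and free: "\<And>k. b \<le> k \<Longrightarrow> k < c \<Longrightarrow> k \<in> free_indices l \<Phi>"
  shows "(a, b) \<in> \<Phi>"
  using assms(1) free
proof (induction b rule: inc_induct)
  case (step k)
  then have "(a, Suc k) \<in> \<Phi>" "k \<notin> col_corners \<Phi>" by (auto simp: free_indices_def)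
  then show ?case by (auto simp: col_corners_def)
qed (rule assms)

text \<open>
  An entry of \<open>bracket A X\<close> arises by moving a position of the support of \<open>X\<close> along a nonzero
  entry of \<open>A\<close>. If that entry lies on or above the diagonal, the move goes up in the root poset.
  If it lies below, all simple roots that it passes belong to \<open>I\<close>, and the move stays in \<open>\<Phi>\<close> because
  these simple roots are free.
\<close>

lemma ad_nilpotent_ideal_supported:
  assumes \<Phi>: "\<Phi> \<in> root_ideals l" and I: "I \<subseteq> simple_root l ` free_indices l \<Phi>"
  shows "ad_nilpotent_ideal l (parabolic l I) (supported l \<Phi>)"
proof -
  have subset: "I \<subseteq> simple_roots l"
    using I by (auto simp: simple_roots_def free_indices_def)
  have free: "k \<in> free_indices l \<Phi>" if "simple_root l k \<in> I" "k < l" for k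
  proof -
    obtain m where m: "m \<in> free_indices l \<Phi>" "simple_root l k = simple_root l m" using I \<open>simple_root l k \<in> I\<close> by blast
    then have "k = m"
      using root_inject[of l k "Suc k" m "Suc m"] that(2)
      by (simp add: simple_root_def free_indices_def)
    then show ?thesis using m by simp
  qed
  have upper: "a < b" if "X \<in> supported l \<Phi>" "a \<le> l" "b \<le> l" "X $$ (a, b) \<noteq> 0" for X a b
    using supportedD(2)[OF that] root_idealsD(1)[OF \<Phi>] by blast
  have diag0: "X $$ (a, a) = 0" if "X \<in> supported l \<Phi>" "a \<le> l" for X a
    using upper[of X a a] that by blast
  have P: "A \<in> carrier_mat (Suc l) (Suc l)" if "A \<in> parabolic l I" for A
    using that by (simp add: parabolic_iff sl_def)
  have levi: "a \<le> c \<or> (\<forall>k. c \<le> k \<longrightarrow> k < a \<longrightarrow> k \<in> free_indices l \<Phi>)"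
    if A: "A \<in> parabolic l I" and ac: "a \<le> l" "c \<le> l" "A $$ (a, c) \<noteq> 0" for A a c
  proof (cases "a \<le> c")
    case False
    have "a = c \<or> root l a c \<in> roots_gen l I \<union> pos_roots l"
      using A ac unfolding parabolic_iff by blast
    then have "root l a c \<in> int_span l I"
      using False ac root_mem_pos_roots_iff[of a c l] by (auto simp: roots_gen_def)
    then have "simple_root l k \<in> I" if "c \<le> k" "k < a" for k
      using simple_root_mem_of_root_mem_int_span[OF subset] that ac by blast
    then show ?thesis using free ac by auto
  qed simp
  have "supported l \<Phi> \<subseteq> parabolic l I"
  proof
    fix X assume X: "X \<in> supported l \<Phi>"
    have "X \<in> sl l" using supportedD(1)[OF X] diag0[OF X] by (simp add: sl_def)
    moreover have "root l a b \<in> pos_roots l" if "a \<le> l" "b \<le> l" "X $$ (a, b) \<noteq> 0" for a b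
      using upper[OF X that] root_mem_pos_roots_iff[of a b l] that by simp
    ultimately show "X \<in> parabolic l I" by (auto simp: parabolic_iff)
  qed
  moreover have "bracket A X \<in> supported l \<Phi>" if A: "A \<in> parabolic l I" and X: "X \<in> supported l \<Phi>" for A X
  proof -
    have "(a, b) \<in> \<Phi>" if ab: "a \<le> l" "b \<le> l" and nz: "bracket A X $$ (a, b) \<noteq> 0" for a b
      using P[OF A] supportedD(1)[OF X] ab nz
    proof (cases rule: bracket_index_nonzeroE)
      case (1 c)
      have cb: "(c, b) \<in> \<Phi>" using supportedD(2)[OF X] 1 ab by blast
      show ?thesis
      proof (cases "a \<le> c")
        case True
        then show ?thesis using root_ideals_up[OF \<Phi> cb] ab by blast
      next
        case False
        then show ?thesis using free_indices_row_step[of c a b \<Phi> l] levi[OF A, of a c] cb ab 1 by simp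
      qed
    next
      case (2 c)
      have ac: "(a, c) \<in> \<Phi>" using supportedD(2)[OF X] 2 ab by blast
      show ?thesis
      proof (cases "c \<le> b")
        case True
        then show ?thesis using root_ideals_up[OF \<Phi> ac] ab by blast
      next
        case False
        then show ?thesis using free_indices_col_step[of b c a \<Phi> l] levi[OF A, of c b] ac ab 2 by simp
      qed
    qed
    then show ?thesis
      using bracket_carrier[OF P[OF A] supportedD(1)[OF X]] by (auto simp: supported_def)
  qed
  moreover have "ad_nilpotent_on l (parabolic l I) X" if "X \<in> supported l \<Phi>" for X
    by (rule ad_nilpotent_on_strictly_upper) (use supportedD(1) upper that P in blast)+
  ultimately show ?thesis
    by (simp add: ad_nilpotent_ideal_def lie_ideal_def lin_subspace_supported)
qed

text \<open>
  For the forward direction \<open>\<Phi>\<close> is the set of positions whose matrix units lie in \<open>N\<close>; they span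
  \<open>N\<close> by \<open>unit_mat_mem_if_index_nonzero\<close>, and brackets with upper triangular matrix units show that
  \<open>\<Phi>\<close> is up-closed.
\<close>

lemma ad_nilpotent_ideal_borel_iff:
  "ad_nilpotent_ideal l (parabolic l {}) N \<longleftrightarrow> N \<in> supported l ` root_ideals l"
proof
  assume N: "ad_nilpotent_ideal l (parabolic l {}) N"
  then have id: "lie_ideal l (parabolic l {}) N"
    and nil: "\<And>X. X \<in> N \<Longrightarrow> ad_nilpotent_on l (parabolic l {}) X"
    by (auto simp: ad_nilpotent_ideal_def)
  then have lin: "lin_subspace l N" and sub: "N \<subseteq> parabolic l {}"
    and br: "\<And>y X. y \<in> parabolic l {} \<Longrightarrow> X \<in> N \<Longrightarrow> bracket y X \<in> N"
    by (auto simp: lie_ideal_def)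
  have car: "X \<in> carrier_mat (Suc l) (Suc l)" if "X \<in> N" for X
    using lin that by (auto simp: lin_subspace_def)
  have upper: "a < b" if "X \<in> N" "a \<le> l" "b \<le> l" "X $$ (a, b) \<noteq> 0" for X a b
  proof -
    have "a \<le> b" using sub that by (auto simp: borel_iff)
    moreover have "a \<noteq> b" using ad_nilpotent_diagonal_zero[of X l a] sub nil that by auto
    ultimately show ?thesis by simp
  qed
  define \<Phi> where "\<Phi> = {(a, b). a \<le> l \<and> b \<le> l \<and> unit_mat l a b \<in> N}"
  have ord: "a < b" "b \<le> l" if "(a, b) \<in> \<Phi>" for a b
    using upper[of "unit_mat l a b" a b] that by (auto simp: \<Phi>_def)
  have unit_borel: "unit_mat l i j \<in> parabolic l {}" if "i < j" "j \<le> l" for i j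
    using that by (auto simp: borel_iff sl_def)
  have left: "(i, b) \<in> \<Phi>" if "(a, b) \<in> \<Phi>" "i < a" for a b i
  proof -
    have ab: "a < b" "b \<le> l" "unit_mat l a b \<in> N" using ord[OF that(1)] that by (auto simp: \<Phi>_def)
    have "bracket (unit_mat l i a) (unit_mat l a b) = unit_mat l i b"
    proof (rule eq_matI)
      fix x y assume "x < dim_row (unit_mat l i b)" "y < dim_col (unit_mat l i b)"
      then have "x \<le> l" "y \<le> l" by auto
      then show "bracket (unit_mat l i a) (unit_mat l a b) $$ (x, y) = unit_mat l i b $$ (x, y)"
        using ab that(2) by (auto simp: bracket_unit_index)
    qed (use bracket_carrier[OF unit_mat_carrier unit_mat_carrier, of l i a a b] in auto)
    then show ?thesis
      using br[OF unit_borel ab(3), of i a] ab that by (simp add: \<Phi>_def)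
  qed
  have right: "(a, j) \<in> \<Phi>" if "(a, b) \<in> \<Phi>" "b < j" "j \<le> l" for a b j
  proof -
    have ab: "a < b" "b \<le> l" "unit_mat l a b \<in> N" using ord[OF that(1)] that by (auto simp: \<Phi>_def)
    \<comment> \<open>This bracket is the negative of the matrix unit at \<open>(a, j)\<close>; a nonzero entry suffices.\<close>
    let ?Y = "bracket (unit_mat l b j) (unit_mat l a b)"
    have Y: "?Y \<in> N" using br[OF unit_borel ab(3)] that by simp
    have "?Y $$ (a, j) \<noteq> 0" using ab that by (simp add: bracket_unit_index)
    then have "unit_mat l a j \<in> N"
      using unit_mat_mem_if_index_nonzero[OF id Y] ab that by simp
    then show ?thesis using ab that by (simp add: \<Phi>_def)
  qed
  have "(i', j') \<in> \<Phi>" if "(i, j) \<in> \<Phi>" "i' \<le> i" "j \<le> j'" "j' \<le> l" for i j i' j'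
  proof -
    have "(i', j) \<in> \<Phi>" using left[of i j i'] that by (cases "i' = i") auto
    then show ?thesis using right[of i' j j'] that by (cases "j = j'") auto
  qed
  then have "\<Phi> \<in> root_ideals l" using ord unfolding root_ideals_def by blast
  moreover have "N = supported l \<Phi>"
  proof (intro equalityI subsetI)
    fix X assume X: "X \<in> N"
    have "unit_mat l a b \<in> N" if "a \<le> l" "b \<le> l" "X $$ (a, b) \<noteq> 0" for a b
      using unit_mat_mem_if_index_nonzero[OF id X upper[OF X that]] that by simp
    then show "X \<in> supported l \<Phi>" using car[OF X] by (auto simp: supported_def \<Phi>_def)
  next
    fix X assume X: "X \<in> supported l \<Phi>"
    show "X \<in> N"
      by (rule mem_lin_subspace_if_unit_mats[OF lin supportedD(1)[OF X]])
        (use supportedD(2)[OF X] in \<open>auto simp: \<Phi>_def\<close>)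
  qed
  ultimately show "N \<in> supported l ` root_ideals l" by blast
next
  assume "N \<in> supported l ` root_ideals l"
  then show "ad_nilpotent_ideal l (parabolic l {}) N"
    using ad_nilpotent_ideal_supported[of _ l "{}"] by auto
qed

lemma unit_mat_neg_simple_mem_parabolic:
  assumes "I \<subseteq> simple_roots l" "simple_root l k \<in> I" "k < l"
  shows "unit_mat l (Suc k) k \<in> parabolic l I"
  using neg_simple_root_mem_roots_gen[OF assms] assms(3)
  by (auto simp: parabolic_iff sl_def)

text \<open>
  A corner in row \<open>k\<close> or in column \<open>k + 1\<close> is moved out of \<open>\<Phi>\<close> by the negative simple root
  vector \<open>unit_mat l (Suc k) k\<close>. This includes the corner \<open>(k, k + 1)\<close> itself, which is moved onto the
  diagonal.
\<close>

lemma free_index_if_ideal: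
  assumes \<Phi>: "\<Phi> \<in> root_ideals l" and I: "I \<subseteq> simple_roots l" "simple_root l k \<in> I" "k < l"
    and id: "lie_ideal l (parabolic l I) (supported l \<Phi>)"
  shows "k \<in> free_indices l \<Phi>"
proof -
  let ?E = "unit_mat l (Suc k) k"
  have br: "bracket ?E X \<in> supported l \<Phi>" if "X \<in> supported l \<Phi>" for X
    using id that unit_mat_neg_simple_mem_parabolic[OF I] by (simp add: lie_ideal_def)
  have "(Suc k, j) \<in> \<Phi>" if kj: "(k, j) \<in> \<Phi>" for j
  proof -
    have "k < j" "j \<le> l" using root_idealsD[OF \<Phi> kj] .
    then have "bracket ?E (unit_mat l k j) \<in> supported l \<Phi>"
      using br kj unit_mat_mem_supported_iff[of k l j] by simp
    moreover have "bracket ?E (unit_mat l k j) $$ (Suc k, j) \<noteq> 0"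
      using \<open>k < j\<close> \<open>j \<le> l\<close> I(3) by (simp add: bracket_unit_index)
    ultimately show ?thesis
      using supportedD(2) \<open>j \<le> l\<close> I(3) by (meson Suc_leI)
  qed
  moreover have "(i, k) \<in> \<Phi>" if ik: "(i, Suc k) \<in> \<Phi>" for i
  proof -
    have "i < Suc k" using root_idealsD[OF \<Phi> ik] by simp
    then have "bracket ?E (unit_mat l i (Suc k)) \<in> supported l \<Phi>"
      using br ik unit_mat_mem_supported_iff[of i l "Suc k"] I(3) by simp
    moreover have "bracket ?E (unit_mat l i (Suc k)) $$ (i, k) \<noteq> 0"
      using \<open>i < Suc k\<close> I(3) by (simp add: bracket_unit_index)
    ultimately show ?thesis
      using supportedD(2) \<open>i < Suc k\<close> I(3) by (meson less_imp_le_nat less_Suc_eq_le order_trans)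
  qed
  ultimately show ?thesis
    using I(3) by (auto simp: free_indices_def row_corners_def col_corners_def)
qed

lemma max_simple_supported:
  assumes \<Phi>: "\<Phi> \<in> root_ideals l"
  shows "max_simple l (supported l \<Phi>) = simple_root l ` free_indices l \<Phi>"
  unfolding max_simple_def
proof (rule Greatest_equality)
  show "simple_root l ` free_indices l \<Phi> \<subseteq> simple_roots l \<and>
      ad_nilpotent_ideal l (parabolic l (simple_root l ` free_indices l \<Phi>)) (supported l \<Phi>)"
    using ad_nilpotent_ideal_supported[OF \<Phi> order_refl]
    by (auto simp: free_indices_def simple_roots_def)
next
  fix I assume I: "I \<subseteq> simple_roots l \<and> ad_nilpotent_ideal l (parabolic l I) (supported l \<Phi>)"
  show "I \<le> simple_root l ` free_indices l \<Phi>"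
  proof
    fix \<alpha> assume "\<alpha> \<in> I"
    moreover from this obtain k where "\<alpha> = simple_root l k" "k < l"
      using I by (auto simp: simple_roots_def)
    ultimately show "\<alpha> \<in> simple_root l ` free_indices l \<Phi>"
      using free_index_if_ideal[OF \<Phi>, of I k] I by (auto simp: ad_nilpotent_ideal_def)
  qed
qed

lemma card_max_simple_supported:
  assumes "\<Phi> \<in> root_ideals l"
  shows "card (max_simple l (supported l \<Phi>)) = card (free_indices l \<Phi>)"
proof -
  have "inj_on (simple_root l) (free_indices l \<Phi>)"
    by (rule inj_onI)
      (use root_inject in \<open>force simp: simple_root_def free_indices_def\<close>)
  then show ?thesis by (simp add: max_simple_supported[OF assms] card_image)
qed

lemma bij_supported:
  "bij_betw (supported l) {\<Phi> \<in> root_ideals l. card (free_indices l \<Phi>) = r}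
     {N. ad_nilpotent_ideal l (parabolic l {}) N \<and> card (max_simple l N) = r}"
  unfolding bij_betw_def
proof
  show "inj_on (supported l) {\<Phi> \<in> root_ideals l. card (free_indices l \<Phi>) = r}"
    using inj_on_supported by (rule inj_on_subset) auto
qed (auto simp: ad_nilpotent_ideal_borel_iff card_max_simple_supported)

section \<open>The bijection\<close>

theorem theorem1:
  fixes l r :: nat
  assumes "l \<ge> 1"
  shows "\<exists>f. bij_betw f
           {N. ad_nilpotent_ideal l (parabolic l {}) N \<and> card (max_simple l N) = r}
           {w. dyck_path (l + 1) w \<and> udu_count w = r}"
proof -
  obtain g where g: "bij_betw g
      {N. ad_nilpotent_ideal l (parabolic l {}) N \<and> card (max_simple l N) = r}
      {\<Phi> \<in> root_ideals l. card (free_indices l \<Phi>) = r}"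
    using bij_betw_inv_into[OF bij_supported] by blast
  have "bij_betw (tree_dyck \<circ> inv_into {t. length (tree_motzkin t) = l \<and> level2_count t = r} tree_motzkin
      \<circ> corner_word l \<circ> g)
      {N. ad_nilpotent_ideal l (parabolic l {}) N \<and> card (max_simple l N) = r}
      {w. dyck_path (l + 1) w \<and> udu_count w = r}"
    using g bij_corner_word bij_betw_inv_into[OF bij_tree_motzkin] bij_tree_dyck
    by (intro bij_betw_trans)
  then show ?thesis by blast
qed

end
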